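(* Let $B$ be a translation invariant random matrix with entries in $\{0\}\cup[1,\infty)$, let $\{B_n\}_{n\in\mathbb{N}^*}$ be independent copies of $B$, and let $\{M_n\}_{n\in\mathbb{N}}$ be the associated process started from a unit mass at the origin. Suppose that there exists $\delta>0$ such that $c_\delta(B_1)>0$. Then for each $\epsilon$ with $0<\epsilon<\delta$ there exists a random path $\{\Gamma(n)\}_{n\in\mathbb{N}}$ in $\mathbb{Z}^d$ such that, almost surely on the event $\{|M_n|\ge 1 \text{ for all } n\in\mathbb{N}\}$, the path $\Gamma$ is open and $$\liminf_{n\to\infty}\frac1n\log M_{n,\Gamma(n)}\ \ge\ c_{\delta-\epsilon}(B_1)\,\log(1+\delta-\epsilon).$$ In particular, $$\liminf_{n\to\infty}\frac1n\log|M_n|\ \ge\ c_\delta(B_1)\,\log(1+\delta)$$ almost surely on $\{|M_n|\ge 1\text{ for all }n\in\mathbb{N}\}$.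
   Context: $\mathbb{N}=\{0,1,2,\dots\}$, $\mathbb{N}^*=\mathbb{N}\setminus\{0\}$, and $o$ is the origin of $\mathbb{Z}^d$. $B=(B_{x,y})_{x,y\in\mathbb{Z}^d}$ is a random matrix with entries in $\{0\}\cup[1,\infty)$; translation invariant means that $(B_{x+z,y+z})_{x,y}$ has the same law as $(B_{x,y})_{x,y}$ for every $z\in\mathbb{Z}^d$. No independence between entries and no finite range is assumed. With independent copies $B_n=(B_{n,x,y})_{x,y\in\mathbb{Z}^d}$, $n\in\mathbb{N}^*$, the $[0,\infty]^{\mathbb{Z}^d}$-valued process $M_n=(M_{n,x})_{x\in\mathbb{Z}^d}$ is defined by $$M_{0,x}=\delta_{o,x},\qquad M_{n,x}=\sum_{y\in\mathbb{Z}^d}M_{n-1,y}B_{n,y,x}\quad(n\in\mathbb{N}^* ),$$ where $\delta_{o,x}$ is the Kronecker delta and $\infty\cdot 0=0$. The total mass is $|M_n|=\sum_{x}M_{n,x}$ (with $\log\infty=\infty$). A sequence $\{\Gamma(n)\}_{n\in\mathbb{N}}\subset\mathbb{Z}^d$ is an open path if $B_{n+1,\Gamma(n),\Gamma(n+1)}\ge 1$ for all $n\in\mathbb{N}$. For $\delta>0$, $$c_\delta(B)=P\big(|M_n|\ge1\text{ for all }n\in\mathbb{N}\big)\,\sup_{x\in\mathbb{Z}^d}P(B_{o,x}\ge1+\delta),$$ where $M$ is the process generated by independent copies of $B$. *)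

theory Defs
  imports "HOL-Probability.Probability"
begin

text \<open>
  The lattice is \<open>int ^ 'd\<close>, whose origin is \<open>0\<close>; its dimension \<open>CARD('d)\<close> is arbitrary.
  A matrix has its two indices paired.
\<close>

type_synonym 'd site = "int ^ 'd"

type_synonym 'd matrix = "'d site \<times> 'd site \<Rightarrow> real"

definition matrix_space :: "('d::finite) matrix measure" where
  "matrix_space = (\<Pi>\<^sub>M p\<in>UNIV. borel)"

definition random_matrix :: "'w measure \<Rightarrow> ('w \<Rightarrow> ('d::finite) matrix) \<Rightarrow> bool" where
  "random_matrix N B \<longleftrightarrow>
     B \<in> N \<rightarrow>\<^sub>M matrix_space \<and> (AE \<omega> in N. \<forall>x y. B \<omega> (x, y) \<in> {0} \<union> {1..})"

definition translation_invariant :: "'w measure \<Rightarrow> ('w \<Rightarrow> ('d::finite) matrix) \<Rightarrow> bool" where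
  "translation_invariant N B \<longleftrightarrow>
     (\<forall>z. distr N matrix_space (\<lambda>\<omega> (x, y). B \<omega> (x + z, y + z)) = distr N matrix_space B)"

text \<open>
  The copies are indexed by the positive integers and may live on another probability space
  than the matrix that is copied.
\<close>

definition independent_copies ::
    "'v measure \<Rightarrow> (nat \<Rightarrow> 'v \<Rightarrow> ('d::finite) matrix) \<Rightarrow> 'w measure \<Rightarrow> ('w \<Rightarrow> 'd matrix) \<Rightarrow> bool" where
  "independent_copies P Bs N B \<longleftrightarrow>
     prob_space.indep_vars P (\<lambda>_. matrix_space) Bs {1..} \<and>
     (\<forall>n\<ge>1. distr P matrix_space (Bs n) = distr N matrix_space B)"

text \<open>
  The process is a function of a realisation \<open>b\<close> of the sequence of matrices; \<open>b 0\<close> is never used.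
  All sums are unconditional sums in the extended nonnegative reals, where \<open>\<infinity> * 0 = 0\<close>.
\<close>

primrec mass :: "(nat \<Rightarrow> ('d::finite) matrix) \<Rightarrow> nat \<Rightarrow> 'd site \<Rightarrow> ennreal" where
  "mass b 0 x = (if x = 0 then 1 else 0)"
| "mass b (Suc n) x = (\<Sum>\<^sub>\<infinity>y. mass b n y * ennreal (b (Suc n) (y, x)))"

definition total_mass :: "(nat \<Rightarrow> ('d::finite) matrix) \<Rightarrow> nat \<Rightarrow> ennreal" where
  "total_mass b n = (\<Sum>\<^sub>\<infinity>x. mass b n x)"

definition open_path :: "(nat \<Rightarrow> ('d::finite) matrix) \<Rightarrow> (nat \<Rightarrow> 'd site) \<Rightarrow> bool" where
  "open_path b \<gamma> \<longleftrightarrow> (\<forall>n. b (Suc n) (\<gamma> n, \<gamma> (Suc n)) \<ge> 1)"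

text \<open>
  The constant depends on the random matrix only through its law, so its first factor is
  computed on the canonical space of sequences of independent copies.
\<close>

definition c_const :: "real \<Rightarrow> 'w measure \<Rightarrow> ('w \<Rightarrow> ('d::finite) matrix) \<Rightarrow> real" where
  "c_const \<delta> N B =
     (let Q = (\<Pi>\<^sub>M n\<in>{1::nat..}. distr N matrix_space B)
      in measure Q {b \<in> space Q. \<forall>n. total_mass b n \<ge> 1}) *
     (SUP x. measure N {\<omega> \<in> space N. B \<omega> (0, x) \<ge> 1 + \<delta>})"

text \<open>Logarithm on the extended nonnegative reals, with \<open>log \<infinity> = \<infinity>\<close> and \<open>log 0 = -\<infinity>\<close>.\<close>

definition eln :: "ennreal \<Rightarrow> ereal" where
  "eln u = (if u = 0 then -\<infinity> else if u = \<infinity> then \<infinity> else ereal (ln (enn2real u)))"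

end

theory Submission
  imports Defs
begin

text \<open>
  Write \<open>a = 1 + \<delta>\<close>, let \<open>q\<close> be the probability that some entry in the row of the origin is at least
  \<open>a\<close>, and \<open>\<rho>\<close> the survival probability; then \<open>c_\<delta> \<le> \<rho> q\<close>. Explore the cluster of the origin by a
  search that only looks at the past: whenever the row of its current site has an entry at least
  \<open>a\<close>, it moves along that entry and stays among the descendants of the landing site until these
  are extinct, and then backtracks. Call a time a renewal if the search takes such an entry and the
  landing site has descendants for ever. As long as the
  cluster lives, a time is a renewal with conditional probability \<open>\<rho> q\<close> given the past. One path
  passes through all renewals, and its mass at time \<open>n\<close> is at least \<open>a\<close> to the number of renewals
  before \<open>n\<close>.

  The environment seen from a landing site is a fresh one conditioned to survive, so the almost sure
  lower bound for the frequency of renewals follows as in the Katznelson--Weiss proof of the ergodic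
  theorem. If the frequency were less than \<open>\<alpha> < \<rho> q\<close> on an event \<open>A\<close> of positive probability,
  one could cover the time axis by bounded intervals of density at most \<open>\<alpha>\<close>, up to a small
  proportion of exceptional renewals, which contradicts \<open>P(A \<inter> {k is a renewal}) \<ge> \<rho> q P(A)\<close>.
\<close>

section \<open>Reachable sites and the search\<close>

text \<open>Choice by the least index in an enumeration rather than by \<open>SOME\<close>, so that
  a choice from a random set is again measurable (\<open>measurable_pick\<close>).\<close>

definition pick :: "'a::countable set \<Rightarrow> 'a" where
  "pick C = from_nat (LEAST n. from_nat n \<in> C)"

lemma pick_in: "C \<noteq> {} \<Longrightarrow> pick C \<in> C"
  unfolding pick_def by (rule LeastI_ex) (metis ex_in_conv from_nat_to_nat)

definition translate :: "'d site \<Rightarrow> ('d::finite) matrix \<Rightarrow> 'd matrix" where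
  "translate z A = (\<lambda>(x, y). A (x + z, y + z))"

lemma translate_apply [simp]: "translate z A (x, y) = A (x + z, y + z)"
  by (simp add: translate_def)

lemma translate_translate [simp]: "translate x (translate y A) = translate (x + y) A"
  by (auto simp: translate_def fun_eq_iff algebra_simps)

lemma translate_0 [simp]: "translate 0 A = A"
  by (auto simp: translate_def fun_eq_iff)

text \<open>From here on a realisation is a sequence \<open>e\<close> in which \<open>e n\<close> governs the step from time \<open>n\<close>
  to time \<open>Suc n\<close>, so that \<open>e n\<close> is the matrix \<open>b (Suc n)\<close> of the definition of \<^const>\<open>mass\<close>.\<close>

definition shift :: "nat \<Rightarrow> 'd site \<Rightarrow> (nat \<Rightarrow> ('d::finite) matrix) \<Rightarrow> nat \<Rightarrow> 'd matrix" where
  "shift m z e = (\<lambda>n. translate z (e (m + n)))"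

lemma shift_apply [simp]: "shift m z e n (x, y) = e (m + n) (x + z, y + z)"
  by (simp add: shift_def)

lemma translate_shift [simp]: "translate w (shift m z e n) = translate (w + z) (e (m + n))"
  by (simp add: shift_def)

lemma shift_shift [simp]: "shift m' z' (shift m z e) = shift (m + m') (z + z') e"
  by (simp add: shift_def algebra_simps)

lemma shift_0 [simp]: "shift 0 0 e = e"
  by (simp add: shift_def)

section \<open>Clusters of sites reachable by open steps\<close>

primrec cluster :: "(nat \<Rightarrow> ('d::finite) matrix) \<Rightarrow> nat \<Rightarrow> 'd site set" where
  "cluster e 0 = {0}"
| "cluster e (Suc n) = {y. \<exists>x\<in>cluster e n. e n (x, y) \<ge> 1}"

lemma cluster_trans:
  assumes "x \<in> cluster e m" "y \<in> cluster (shift m x e) n"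
  shows "x + y \<in> cluster e (m + n)"
  using assms(2)
proof (induction n arbitrary: y)
  case 0
  then show ?case using assms(1) by simp
next
  case (Suc n)
  then obtain w where w: "w \<in> cluster (shift m x e) n" "e (m + n) (w + x, y + x) \<ge> 1" by auto
  from Suc.IH[OF w(1)] w(2) show ?case by (auto simp: algebra_simps)
qed

text \<open>The recursion of \<open>cluster\<close> splits off the last step; the construction of
  the path in \<open>leads_step\<close> needs the first one.\<close>

lemma cluster_Suc_first:
  assumes "y \<in> cluster e (Suc n)"
  obtains x where "e 0 (0, x) \<ge> 1" "y - x \<in> cluster (shift 1 x e) n"
proof -
  have "\<exists>x. e 0 (0, x) \<ge> 1 \<and> y - x \<in> cluster (shift 1 x e) n"
    using assms
  proof (induction n arbitrary: y)
    case 0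
    then show ?case by auto
  next
    case (Suc n)
    then obtain w where w: "w \<in> cluster e (Suc n)" "e (Suc n) (w, y) \<ge> 1" by auto
    from Suc.IH[OF w(1)] obtain x where "e 0 (0, x) \<ge> 1" "w - x \<in> cluster (shift 1 x e) n"
      by blast
    with w(2) show ?case
      by (intro exI[of _ x]) (auto intro!: bexI[of _ "w - x"])
  qed
  with that show thesis by blast
qed

lemma cluster_cong:
  assumes "\<And>j. j < n \<Longrightarrow> e j = e' j"
  shows "cluster e n = cluster e' n"
  using assms by (induction n) auto

definition survives :: "(nat \<Rightarrow> ('d::finite) matrix) \<Rightarrow> bool" where
  "survives e \<longleftrightarrow> (\<forall>n. cluster e n \<noteq> {})"

text \<open>An extinct cluster stays extinct, while by \<open>cluster_trans\<close> the descendants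
  of \<open>x\<close> populate the cluster at every time from \<open>m\<close> on.\<close>

lemma survives_shiftD:
  assumes "survives (shift m x e)" "x \<in> cluster e m"
  shows "survives e"
  unfolding survives_def
proof
  fix n
  show "cluster e n \<noteq> {}"
  proof
    assume empty: "cluster e n = {}"
    have "cluster e (n + k) = {}" for k by (induction k) (auto simp: empty)
    then show False using assms cluster_trans[OF assms(2)]
      unfolding survives_def by (metis add.commute ex_in_conv)
  qed
qed

section \<open>Depth-first search along large entries\<close>

definition leap :: "real \<Rightarrow> ('d::finite) matrix \<Rightarrow> bool" where
  "leap a A \<longleftrightarrow> (\<exists>z. A (0, z) \<ge> a)"

definition landing :: "real \<Rightarrow> ('d::finite) matrix \<Rightarrow> 'd site" where
  "landing a A = pick {z. A (0, z) \<ge> a}"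

lemma landing: "leap a A \<Longrightarrow> A (0, landing a A) \<ge> a"
  using pick_in[of "{z. A (0, z) \<ge> a}"] by (auto simp: leap_def landing_def)

definition dead :: "(nat \<Rightarrow> ('d::finite) matrix) \<Rightarrow> nat \<Rightarrow> nat \<times> 'd site \<Rightarrow> bool" where
  "dead e k p \<longleftrightarrow> cluster (shift (fst p) (snd p) e) (k - fst p) = {}"

text \<open>A depth-first search that only uses the past: an entry \<open>(j, b)\<close> of the stack is a site \<open>b\<close>
  reached at time \<open>j\<close> by an entry of size at least \<open>a\<close>, and the search stays among the descendants
  of the top entry until these have died out.\<close>

primrec site_of :: "(nat \<Rightarrow> ('d::finite) matrix) \<Rightarrow> nat \<Rightarrow> (nat \<times> 'd site) list \<Rightarrow> 'd site" where
  "site_of e k [] = 0"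
| "site_of e k (p # s) = snd p + pick (cluster (shift (fst p) (snd p) e) (k - fst p))"

definition push :: "real \<Rightarrow> (nat \<Rightarrow> ('d::finite) matrix) \<Rightarrow> nat \<Rightarrow> (nat \<times> 'd site) list \<Rightarrow> (nat \<times> 'd site) list" where
  "push a e k s =
     (let x = site_of e k s; A = translate x (e k)
      in if s \<noteq> [] \<and> leap a A then (Suc k, x + landing a A) # s else s)"

text \<open>The bottom entry \<open>(0, 0)\<close> is the origin, so the stack becomes empty only
  when the whole cluster is extinct. An entry pushed at time \<open>k\<close> is dated
  \<open>Suc k\<close>, hence never dead on arrival.\<close>

primrec stack :: "real \<Rightarrow> (nat \<Rightarrow> ('d::finite) matrix) \<Rightarrow> nat \<Rightarrow> (nat \<times> 'd site) list" where
  "stack a e 0 = [(0, 0)]"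
| "stack a e (Suc k) = dropWhile (dead e (Suc k)) (push a e k (stack a e k))"

definition cur :: "real \<Rightarrow> (nat \<Rightarrow> ('d::finite) matrix) \<Rightarrow> nat \<Rightarrow> 'd site" where
  "cur a e k = site_of e k (stack a e k)"

definition land :: "real \<Rightarrow> (nat \<Rightarrow> ('d::finite) matrix) \<Rightarrow> nat \<Rightarrow> 'd site" where
  "land a e k = cur a e k + landing a (translate (cur a e k) (e k))"

definition attempt :: "real \<Rightarrow> (nat \<Rightarrow> ('d::finite) matrix) \<Rightarrow> nat \<Rightarrow> bool" where
  "attempt a e k \<longleftrightarrow> stack a e k \<noteq> [] \<and> leap a (translate (cur a e k) (e k))"

text \<open>The first condition depends only on the matrices up to \<open>e k\<close>, the second on
  the later ones seen from \<open>land a e k\<close>; this split is what makes probabilities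
  factor.\<close>

definition renewal :: "real \<Rightarrow> (nat \<Rightarrow> ('d::finite) matrix) \<Rightarrow> nat \<Rightarrow> bool" where
  "renewal a e k \<longleftrightarrow> attempt a e k \<and> survives (shift (Suc k) (land a e k) e)"

lemma stack_Suc:
  "stack a e (Suc k) =
     dropWhile (dead e (Suc k))
       (if attempt a e k then (Suc k, land a e k) # stack a e k else stack a e k)"
  by (simp add: push_def attempt_def land_def cur_def Let_def)

lemma attempt_step: "attempt a e k \<Longrightarrow> e k (cur a e k, land a e k) \<ge> a"
  using landing[of a "translate (cur a e k) (e k)"]
  by (auto simp: attempt_def land_def add.commute)

lemma cluster_cong_shift:
  assumes "\<And>j. j < k \<Longrightarrow> e j = e' j"
  shows "cluster (shift m z e) (k - m) = cluster (shift m z e') (k - m)"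
  using assms by (intro cluster_cong) (auto simp: shift_def)

lemma site_of_cong:
  assumes "\<And>j. j < k \<Longrightarrow> e j = e' j"
  shows "site_of e k s = site_of e' k s"
  using cluster_cong_shift[of k e e'] assms by (cases s) auto

text \<open>The search is adapted: its state at time \<open>k\<close> has read only matrices before
  time \<open>k\<close>, as \<open>measure_past_shift\<close> requires.\<close>

lemma stack_cong:
  assumes "\<And>j. j < k \<Longrightarrow> e j = e' j"
  shows "stack a e k = stack a e' k"
  using assms
proof (induction k)
  case (Suc k)
  then have "dead e (Suc k) = dead e' (Suc k)"
    using cluster_cong_shift[of "Suc k" e e'] by (auto simp: dead_def fun_eq_iff)
  moreover have "push a e k (stack a e k) = push a e' k (stack a e' k)"
    using Suc site_of_cong[of k e e'] by (simp add: push_def)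
  ultimately show ?case by simp
qed simp

lemma cur_cong:
  assumes "\<And>j. j < k \<Longrightarrow> e j = e' j"
  shows "cur a e k = cur a e' k"
  using stack_cong[of k e e' a] site_of_cong[of k e e'] assms by (simp add: cur_def)

lemma attempt_land_cong:
  assumes "\<And>j. j < Suc k \<Longrightarrow> e j = e' j"
  shows "attempt a e k = attempt a e' k" "land a e k = land a e' k"
  using stack_cong[of k e e' a] cur_cong[of k e e' a] assms by (auto simp: attempt_def land_def)

lemma dropWhile_keeps_last:
  "xs \<noteq> [] \<Longrightarrow> \<not> P (last xs) \<Longrightarrow> dropWhile P xs \<noteq> [] \<and> last (dropWhile P xs) = last xs"
  by (induction xs) (auto split: if_splits)

lemma stack_survives:
  assumes "survives e"
  shows "stack a e k \<noteq> [] \<and> last (stack a e k) = (0, 0)"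
proof (induction k)
  case (Suc k)
  let ?s = "push a e k (stack a e k)"
  have "?s \<noteq> []" "last ?s = (0, 0)" using Suc by (auto simp: push_def Let_def)
  moreover have "\<not> dead e (Suc k) (0, 0)"
    using assms[unfolded survives_def, rule_format, of "Suc k"] by (simp add: dead_def)
  ultimately show ?case using dropWhile_keeps_last[of ?s "dead e (Suc k)"] by simp
qed simp

lemma cur_in_cluster_if:
  assumes "stack a e k \<noteq> []" "\<not> dead e k (hd (stack a e k))"
    and "\<And>p. p \<in> set (stack a e k) \<Longrightarrow> fst p \<le> k \<and> snd p \<in> cluster e (fst p)"
  shows "cur a e k \<in> cluster e k"
proof -
  obtain p s where s: "stack a e k = p # s" using assms(1) by (cases "stack a e k") auto
  have "pick (cluster (shift (fst p) (snd p) e) (k - fst p)) \<in> cluster (shift (fst p) (snd p) e) (k - fst p)"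
    using assms(2) s by (intro pick_in) (simp add: dead_def)
  moreover have "fst p \<le> k" "snd p \<in> cluster e (fst p)" using assms(3)[of p] s by auto
  ultimately show ?thesis using cluster_trans[of "snd p" e "fst p" _ "k - fst p"] s
    by (simp add: cur_def)
qed

text \<open>The two invariants go together: a new entry lies in the cluster because the current site
  does, and this in turn needs a live top entry.\<close>

lemma stack_entries:
  assumes "a \<ge> 1"
  shows "(\<forall>p\<in>set (stack a e k). fst p \<le> k \<and> snd p \<in> cluster e (fst p)) \<and>
    (stack a e k \<noteq> [] \<longrightarrow> \<not> dead e k (hd (stack a e k)))"
proof (induction k)
  case 0
  then show ?case by (simp add: dead_def)
next
  case (Suc k)
  have *: "land a e k \<in> cluster e (Suc k)" if "attempt a e k"
    using cur_in_cluster_if[of a e k] Suc that attempt_step[OF that] assms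
    by (auto simp: attempt_def intro!: bexI[of _ "cur a e k"])
  have "fst p \<le> Suc k \<and> snd p \<in> cluster e (fst p)" if "p \<in> set (stack a e (Suc k))" for p
    using that[unfolded stack_Suc, THEN set_dropWhileD] Suc * by (fastforce split: if_splits)
  then show ?case using hd_dropWhile[of "dead e (Suc k)"] by auto
qed

lemma cur_in_cluster:
  assumes "a \<ge> 1" "stack a e k \<noteq> []"
  shows "cur a e k \<in> cluster e k"
  using cur_in_cluster_if[OF assms(2)] stack_entries[OF assms(1), of e k] assms(2) by blast

lemma land_in_cluster:
  assumes "a \<ge> 1" "attempt a e k"
  shows "land a e k \<in> cluster e (Suc k)"
  using cur_in_cluster[of a e k] attempt_step[OF assms(2)] assms
  by (auto simp: attempt_def intro!: bexI[of _ "cur a e k"])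

lemma renewal_survives:
  assumes "a \<ge> 1" "renewal a e k"
  shows "survives e"
  using survives_shiftD land_in_cluster assms unfolding renewal_def by blast

text \<open>The entry pushed at a renewal never dies out, so the search never looks below it again.\<close>

lemma stack_after_renewal:
  assumes "renewal a e k"
  shows "stack a e (Suc k + m) =
    map (\<lambda>(j, b). (Suc k + j, land a e k + b)) (stack a (shift (Suc k) (land a e k) e) m) @ stack a e k"
proof (induction m)
  case 0
  have "attempt a e k" using assms by (simp add: renewal_def)
  then show ?case unfolding add_0_right stack_Suc by (simp add: dead_def)
next
  case (Suc m)
  define z e' g s where "z = land a e k" and "e' = shift (Suc k) z e"
    and "g = (\<lambda>(j, b). (Suc k + j, z + b))" and "s = stack a e k"
  have sv: "survives e'" using assms by (simp add: renewal_def z_def e'_def)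
  have IH: "stack a e (Suc k + m) = map g (stack a e' m) @ s"
    using Suc by (simp add: g_def z_def e'_def s_def)
  have dead_g: "dead e (Suc k + n) (g p) = dead e' n p" for n p
    by (cases p) (simp add: g_def e'_def dead_def)
  have site: "site_of e (Suc k + m) (map g t @ s) = z + site_of e' m t" if "t \<noteq> []" for t
    using that by (cases t) (auto simp: g_def e'_def split: prod.split)
  note ne = stack_survives[OF sv, of a]
  have psh: "push a e (Suc k + m) (map g (stack a e' m) @ s) = map g (push a e' m (stack a e' m)) @ s"
  proof -
    define w where "w = site_of e' m (stack a e' m)"
    have "site_of e (Suc k + m) (map g (stack a e' m) @ s) = z + w"
      using site ne by (simp add: w_def)
    moreover have "translate w (e' m) = translate (z + w) (e (Suc k + m))"
      by (simp add: e'_def add.commute)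
    ultimately show ?thesis
      using ne[of m] unfolding push_def w_def[symmetric] by (simp add: Let_def g_def add.assoc)
  qed
  have nep: "push a e' m (stack a e' m) \<noteq> []" using ne[of m] by (simp add: push_def Let_def)
  have "stack a e (Suc k + Suc m) = dropWhile (dead e (Suc k + Suc m)) (map g (push a e' m (stack a e' m)) @ s)"
    using psh IH by simp
  \<comment> \<open>The fresh search in \<open>e'\<close> survives and keeps its root, so a live
    entry stops \<open>dropWhile\<close> before it reaches the old part \<open>s\<close>.\<close>
  also have "\<dots> = dropWhile (dead e (Suc k + Suc m)) (map g (push a e' m (stack a e' m))) @ s"
  proof -
    have "stack a e' (Suc m) \<noteq> []" using ne by blast
    then obtain p where "p \<in> set (push a e' m (stack a e' m))" "\<not> dead e' (Suc m) p"
      by (auto simp: dropWhile_eq_Nil_conv)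
    then have "g p \<in> set (map g (push a e' m (stack a e' m)))" "\<not> dead e (Suc k + Suc m) (g p)"
      using dead_g[of "Suc m" p] by auto
    then show ?thesis by (rule dropWhile_append1)
  qed
  also have "\<dots> = map g (stack a e' (Suc m)) @ s"
    using dead_g[of "Suc m"] by (simp only: dropWhile_map stack.simps o_def)
  finally show ?case by (simp only: g_def z_def e'_def s_def)
qed

text \<open>Regeneration: only the part of the stack above the old entries is consulted, so after a
  renewal the search is a fresh one in the environment seen from the landing site, up to
  translation.\<close>

lemma after_renewal:
  assumes "renewal a e k"
  defines "e' \<equiv> shift (Suc k) (land a e k) e"
  shows "cur a e (Suc k + m) = land a e k + cur a e' m"
    and "land a e (Suc k + m) = land a e k + land a e' m"
    and "renewal a e (Suc k + m) \<longleftrightarrow> renewal a e' m"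
proof -
  have sv: "survives e'" using assms by (simp add: renewal_def)
  note ne = stack_survives[OF sv, of a m]
  note st = stack_after_renewal[OF assms(1), of m, folded e'_def]
  show cur: "cur a e (Suc k + m) = land a e k + cur a e' m"
    unfolding cur_def st using ne by (cases "stack a e' m") (auto simp: e'_def)
  show land: "land a e (Suc k + m) = land a e k + land a e' m"
    unfolding land_def[of a e "Suc k + m"] land_def[of a e' m] cur by (simp add: e'_def algebra_simps)
  have "attempt a e (Suc k + m) \<longleftrightarrow> attempt a e' m"
    unfolding attempt_def cur unfolding st using ne by (simp add: e'_def algebra_simps)
  then show "renewal a e (Suc k + m) \<longleftrightarrow> renewal a e' m"
    unfolding renewal_def land by (simp add: e'_def)
qed

section \<open>Counting renewals: slow environments and coverings\<close>

definition renewals :: "real \<Rightarrow> (nat \<Rightarrow> ('d::finite) matrix) \<Rightarrow> nat \<Rightarrow> nat" where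
  "renewals a e n = card {k. k < n \<and> renewal a e k}"

lemma renewals_mono: "m \<le> n \<Longrightarrow> renewals a e m \<le> renewals a e n"
  unfolding renewals_def by (rule card_mono) auto

lemma renewals_le: "renewals a e n \<le> n"
  using card_mono[of "{..<n}" "{k. k < n \<and> renewal a e k}"] by (auto simp: renewals_def)

lemma renewals_add:
  assumes "renewal a e k"
  shows "renewals a e (Suc k + n) =
    renewals a e (Suc k) + renewals a (shift (Suc k) (land a e k) e) n"
proof -
  let ?A = "{j. j < n \<and> renewal a (shift (Suc k) (land a e k) e) j}"
  have "{j. j < Suc k + n \<and> renewal a e j} =
      {j. j < Suc k \<and> renewal a e j} \<union> (+) (Suc k) ` ?A" (is "?L = ?R1 \<union> ?R2")
  proof (intro set_eqI iffI)
    fix j assume j: "j \<in> ?L"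
    show "j \<in> ?R1 \<union> ?R2"
    proof (cases "j < Suc k")
      case False
      then obtain m where "j = Suc k + m" using less_eqE by (metis not_less)
      with j show ?thesis using after_renewal(3)[OF assms, of m] by auto
    qed (use j in auto)
  qed (use after_renewal(3)[OF assms] in auto)
  moreover have "card (?R1 \<union> ?R2) = card ?R1 + card ?R2"
    by (rule card_Un_disjoint) auto
  moreover have "card ?R2 = card ?A" by (rule card_image) simp
  ultimately show ?thesis by (simp add: renewals_def)
qed

lemma renewals_Suc: "renewals a e (Suc k) = renewals a e k + (if renewal a e k then 1 else 0)"
proof -
  have "{j. j < Suc k \<and> renewal a e j} =
      (if renewal a e k then insert k else id) {j. j < k \<and> renewal a e j}"
    by (auto simp: less_Suc_eq)
  then show ?thesis by (simp add: renewals_def)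
qed

text \<open>The deficit \<open>\<alpha> * n - renewals a e n\<close> is unbounded. The arbitrary
  slack \<open>K\<close> makes this insensitive to finite changes, and its failure for a surviving
  environment gives a bound valid for all \<open>n\<close>.\<close>

definition slow :: "real \<Rightarrow> real \<Rightarrow> (nat \<Rightarrow> ('d::finite) matrix) \<Rightarrow> bool" where
  "slow a \<alpha> e \<longleftrightarrow> survives e \<and> (\<forall>K::nat. \<exists>n. real (renewals a e n) + real K < \<alpha> * real n)"

text \<open>Passing to the landing site removes \<open>Suc k\<close> units of time and at most as
  many renewals; a larger slack absorbs both. Slowness thus plays the role of the invariant event in
  the ergodic theorem.\<close>

lemma slow_shift:
  assumes "a \<ge> 1" "\<alpha> \<ge> 0" "renewal a e k"
  shows "slow a \<alpha> (shift (Suc k) (land a e k) e) \<longleftrightarrow> slow a \<alpha> e"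
proof -
  define e' where "e' = shift (Suc k) (land a e k) e"
  have sv: "survives e" "survives e'"
    using renewal_survives[OF assms(1,3)] assms(3) by (auto simp: renewal_def e'_def)
  have add: "renewals a e (Suc k + n) = renewals a e (Suc k) + renewals a e' n" for n
    using renewals_add[OF assms(3)] by (simp add: e'_def)
  have "\<exists>n. real (renewals a e n) + real K < \<alpha> * real n"
    if *: "\<forall>K::nat. \<exists>n. real (renewals a e' n) + real K < \<alpha> * real n" for K :: nat
  proof -
    obtain n where n: "real (renewals a e' n) + real (K + Suc k) < \<alpha> * real n" using * by blast
    have "renewals a e (Suc k) \<le> Suc k" by (rule renewals_le)
    then have "real (renewals a e (Suc k + n)) \<le> real (Suc k) + real (renewals a e' n)"
      unfolding add by simp
    moreover have "\<alpha> * real n \<le> \<alpha> * real (Suc k + n)" using assms(2) by (intro mult_left_mono) auto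
    ultimately show ?thesis using n by (intro exI[of _ "Suc k + n"]) (auto simp del: of_nat_Suc)
  qed
  moreover have "\<exists>n. real (renewals a e' n) + real K < \<alpha> * real n"
    if *: "\<forall>K::nat. \<exists>n. real (renewals a e n) + real K < \<alpha> * real n" for K :: nat
  proof -
    \<comment> \<open>\<open>J\<close> compensates the loss of
      \<open>\<alpha> * real (Suc k)\<close> caused by dropping the first \<open>Suc k\<close>
      steps, and also forces \<open>n\<close> to lie beyond them.\<close>
    obtain J :: nat where J: "\<alpha> * real (Suc k) \<le> real J" using real_arch_simple by blast
    obtain n where n: "real (renewals a e n) + real (K + J) < \<alpha> * real n" using * by blast
    have "Suc k < n"
    proof (rule ccontr)
      assume "\<not> Suc k < n"
      then have "\<alpha> * real n \<le> \<alpha> * real (Suc k)" using assms(2) by (intro mult_left_mono) auto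
      with n J show False by simp
    qed
    then obtain i where i: "n = Suc k + i" using less_imp_add_positive by blast
    have "real (renewals a e' i) + real K < \<alpha> * real i"
      using n J add[of i] unfolding i by (auto simp: algebra_simps)
    then show ?thesis by blast
  qed
  ultimately show ?thesis using sv unfolding slow_def e'_def[symmetric] by blast
qed

text \<open>To be read with \<open>e\<close> as the environment seen from the landing site of a
  renewal \<open>k\<close>. The 1 counts that renewal and \<open>i - 1\<close> is the rest of an
  interval of length \<open>i\<close> beginning at \<open>k\<close>; none of length at most
  \<open>H\<close> has density below \<alpha>.\<close>

definition lagging :: "real \<Rightarrow> real \<Rightarrow> nat \<Rightarrow> (nat \<Rightarrow> ('d::finite) matrix) \<Rightarrow> bool" where
  "lagging a \<alpha> H e \<longleftrightarrow> (\<forall>i\<in>{1..H}. \<alpha> * real i \<le> 1 + real (renewals a e (i - 1)))"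

lemma slow_imp_not_lagging:
  assumes "slow a \<alpha> e"
  obtains H where "\<not> lagging a \<alpha> H e"
proof -
  \<comment> \<open>The slack 1 pays for the summand 1 in \<open>lagging\<close>.\<close>
  obtain n where n: "real (renewals a e n) + real (1::nat) < \<alpha> * real n"
    using assms unfolding slow_def by blast
  then have "n \<ge> 1" by (cases n) auto
  moreover have "renewals a e (n - 1) \<le> renewals a e n" by (rule renewals_mono) simp
  ultimately have "\<not> lagging a \<alpha> n e" using n unfolding lagging_def by force
  then show thesis by (rule that)
qed

text \<open>Cover \<open>{l..<n}\<close> greedily by intervals of length at most \<open>H\<close> in which \<open>R\<close> has density at
  most \<open>\<alpha>\<close>; only the points of \<open>D\<close> and the last interval escape.\<close>

lemma density_by_tiling:
  fixes R D :: "nat set" and \<alpha> :: real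
  assumes "\<alpha> \<ge> 0" and "l \<le> n"
    and tile: "\<And>k. k \<in> R \<Longrightarrow> k \<notin> D \<Longrightarrow> \<exists>i\<in>{1..H}. real (card (R \<inter> {k..<k + i})) \<le> \<alpha> * real i"
  shows "real (card (R \<inter> {l..<n})) \<le> \<alpha> * real (n - l) + real (card (D \<inter> {l..<n})) + real H"
  using assms(2)
proof (induction "n - l" arbitrary: l rule: less_induct)
  case less
  have split: "card (X \<inter> {l..<n}) = card (X \<inter> {l..<m}) + card (X \<inter> {m..<n})"
    if "l \<le> m" "m \<le> n" for X :: "nat set" and m
  proof -
    have "X \<inter> {l..<n} = (X \<inter> {l..<m}) \<union> (X \<inter> {m..<n})" using that by auto
    then show ?thesis by (simp add: card_Un_disjoint disjoint_iff)
  qed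
  show ?case
  \<comment> \<open>Apart from the end \<open>l = n\<close>, a start outside \<open>R\<close> or
    inside \<open>D\<close> is passed in a single step: it adds nothing to the count of
    \<open>R\<close>, or is paid for by \<open>D\<close>.\<close>
  proof (cases "l = n \<or> l \<notin> R \<or> l \<in> D")
    case True
    show ?thesis
    proof (cases "l = n")
      case False
      then have l: "l < n" using less.prems by simp
      have "{l..<Suc l} = {l}" by auto
      then have "card (R \<inter> {l..<Suc l}) \<le> card (D \<inter> {l..<Suc l})"
        using True False by (cases "l \<in> R") auto
      moreover have "real (card (R \<inter> {Suc l..<n}))
          \<le> \<alpha> * real (n - Suc l) + real (card (D \<inter> {Suc l..<n})) + real H"
        using less.hyps[of "Suc l"] l by simp
      moreover have "\<alpha> * real (n - Suc l) \<le> \<alpha> * real (n - l)"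
        using assms(1) by (intro mult_left_mono) auto
      ultimately show ?thesis using l split[of "Suc l" R] split[of "Suc l" D] by simp
    qed simp
  next
    case False
    then obtain i where i: "i \<in> {1..H}" "real (card (R \<inter> {l..<l + i})) \<le> \<alpha> * real i"
      using tile by blast
    show ?thesis
    proof (cases "l + i \<le> n")
      case True
      have "real (card (R \<inter> {l + i..<n}))
          \<le> \<alpha> * real (n - (l + i)) + real (card (D \<inter> {l + i..<n})) + real H"
        using i True by (intro less.hyps) auto
      moreover have "\<alpha> * real (n - l) = \<alpha> * real i + \<alpha> * real (n - (l + i))"
        using True by (simp add: of_nat_diff algebra_simps)
      ultimately show ?thesis
        using i True split[of "l + i" R] split[of "l + i" D] by simp
    next
      \<comment> \<open>The tile overruns \<open>n\<close>, so fewer than \<open>H\<close> points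
        are left; this is the source of the term \<open>H\<close>.\<close>
      case False
      have "card (R \<inter> {l..<n}) \<le> card {l..<n}" by (rule card_mono) auto
      also have "\<dots> \<le> H" using False i by auto
      finally show ?thesis using assms(1) by (simp add: add_increasing)
    qed
  qed
qed

text \<open>The exceptional points \<open>D\<close> of the tiling.\<close>

definition lagging_renewal :: "real \<Rightarrow> real \<Rightarrow> nat \<Rightarrow> (nat \<Rightarrow> ('d::finite) matrix) \<Rightarrow> nat \<Rightarrow> bool" where
  "lagging_renewal a \<alpha> H e k \<longleftrightarrow>
     renewal a e k \<and> lagging a \<alpha> H (shift (Suc k) (land a e k) e)"

lemma renewals_le_lagging:
  assumes "\<alpha> \<ge> 0"
  shows "real (renewals a e n) \<le> \<alpha> * real n + real (card {k. k < n \<and> lagging_renewal a \<alpha> H e k}) + real H"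
proof -
  let ?R = "{k. renewal a e k}" and ?D = "{k. lagging_renewal a \<alpha> H e k}"
  have "real (card (?R \<inter> {0..<n})) \<le> \<alpha> * real (n - 0) + real (card (?D \<inter> {0..<n})) + real H"
  proof (rule density_by_tiling[OF assms])
    fix k assume k: "k \<in> ?R" "k \<notin> ?D"
    then obtain i where i: "i \<in> {1..H}"
      "1 + real (renewals a (shift (Suc k) (land a e k) e) (i - 1)) < \<alpha> * real i"
      by (auto simp: lagging_renewal_def lagging_def not_le)
    have "{j. j < k + i \<and> renewal a e j} = {j. j < k \<and> renewal a e j} \<union> (?R \<inter> {k..<k + i})"
      using i by auto
    then have "renewals a e (k + i) = renewals a e k + card (?R \<inter> {k..<k + i})"
      by (simp add: renewals_def card_Un_disjoint disjoint_iff)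
    moreover have "renewals a e (Suc k + (i - 1)) =
        renewals a e k + 1 + renewals a (shift (Suc k) (land a e k) e) (i - 1)"
      using renewals_add[of a e k "i - 1"] renewals_Suc[of a e k] k by simp
    moreover have "Suc k + (i - 1) = k + i" using i by simp
    ultimately have "card (?R \<inter> {k..<k + i}) = 1 + renewals a (shift (Suc k) (land a e k) e) (i - 1)"
      by simp
    then show "\<exists>i\<in>{1..H}. real (card (?R \<inter> {k..<k + i})) \<le> \<alpha> * real i"
      using i by (intro bexI[of _ i]) auto
  qed simp
  moreover have "?R \<inter> {0..<n} = {k. k < n \<and> renewal a e k}"
    "?D \<inter> {0..<n} = {k. k < n \<and> lagging_renewal a \<alpha> H e k}" by auto
  ultimately show ?thesis by (simp add: renewals_def)
qed

subsection \<open>The path through all renewals\<close>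

text \<open>The invariant of the path: no later renewal has become unreachable from
  \<open>x\<close>. Unlike the search, it looks into the future.\<close>

definition leads :: "real \<Rightarrow> (nat \<Rightarrow> ('d::finite) matrix) \<Rightarrow> nat \<Rightarrow> 'd site \<Rightarrow> bool" where
  "leads a e n x \<longleftrightarrow> (\<forall>k\<ge>n. renewal a e k \<longrightarrow> cur a e k - x \<in> cluster (shift n x e) (k - n))"

primrec renewal_path :: "real \<Rightarrow> (nat \<Rightarrow> ('d::finite) matrix) \<Rightarrow> nat \<Rightarrow> 'd site" where
  "renewal_path a e 0 = 0"
| "renewal_path a e (Suc n) =
     (if renewal a e n then land a e n
      else pick {y. e n (renewal_path a e n, y) \<ge> 1 \<and> leads a e (Suc n) y})"

lemma leads_land:
  assumes "a \<ge> 1" "renewal a e n"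
  shows "leads a e (Suc n) (land a e n)"
  unfolding leads_def
proof (intro allI impI)
  fix k assume "Suc n \<le> k" "renewal a e k"
  then obtain m where m: "k = Suc n + m" using le_Suc_ex by blast
  let ?e = "shift (Suc n) (land a e n) e"
  have "survives ?e" using assms by (simp add: renewal_def)
  then have "cur a ?e m \<in> cluster ?e m"
    using cur_in_cluster[OF assms(1)] stack_survives by blast
  then show "cur a e k - land a e n \<in> cluster ?e (k - Suc n)"
    using after_renewal(1)[OF assms(2), of m] m by simp
qed

text \<open>Only the next renewal \<open>k\<close> matters: the first step of an open path to its
  site keeps it within reach, and all later renewals are reached through its landing site by
  \<open>leads_land\<close>.\<close>

lemma leads_step:
  assumes a: "a \<ge> 1" and x: "leads a e n x" and n: "\<not> renewal a e n" and k: "\<exists>k\<ge>n. renewal a e k"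
  obtains y where "e n (x, y) \<ge> 1" "leads a e (Suc n) y"
proof -
  define k where "k = (LEAST k. k \<ge> n \<and> renewal a e k)"
  have k: "k \<ge> n" "renewal a e k"
    using LeastI_ex[of "\<lambda>k. k \<ge> n \<and> renewal a e k"] k by (auto simp: k_def)
  have least: "k \<le> j" if "j \<ge> n" "renewal a e j" for j
    unfolding k_def using that by (intro Least_le) auto
  have "k \<noteq> n" using k n by auto
  then obtain m where m: "k = Suc n + m" using k(1) by (metis le_Suc_ex le_neq_implies_less Suc_leI)
  have "cur a e k - x \<in> cluster (shift n x e) (Suc m)"
    using x k m unfolding leads_def by (metis add_Suc_shift add_diff_cancel_left')
  then obtain z where z: "shift n x e 0 (0, z) \<ge> 1"
    "cur a e k - x - z \<in> cluster (shift 1 z (shift n x e)) m" by (rule cluster_Suc_first)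
  have reach: "cur a e k - (x + z) \<in> cluster (shift (Suc n) (x + z) e) m"
    using z(2) by (simp add: algebra_simps)
  have "leads a e (Suc n) (x + z)"
    unfolding leads_def
  proof (intro allI impI)
    fix j assume j: "Suc n \<le> j" "renewal a e j"
    show "cur a e j - (x + z) \<in> cluster (shift (Suc n) (x + z) e) (j - Suc n)"
    proof (cases "j = k")
      case True
      then show ?thesis using reach m by simp
    next
      case False
      then have "Suc k \<le> j" using least[of j] j by simp
      then obtain i where i: "j = Suc k + i" using le_Suc_ex by blast
      have "land a e k - (x + z) \<in> cluster (shift (Suc n) (x + z) e) (Suc m)"
        using reach attempt_step[of a e k] k(2) a m
        by (auto simp: renewal_def intro!: bexI[of _ "cur a e k - (x + z)"])
      moreover have "cur a e j - land a e k \<in> cluster (shift (Suc k) (land a e k) e) i"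
        using leads_land[OF a k(2)] j i unfolding leads_def by (metis add_diff_cancel_left' le_add1)
      ultimately have "land a e k - (x + z) + (cur a e j - land a e k)
          \<in> cluster (shift (Suc n) (x + z) e) (Suc m + i)"
        by (intro cluster_trans) (use m in auto)
      then show ?thesis using i m by (simp add: algebra_simps)
    qed
  qed
  moreover have "e n (x, x + z) \<ge> 1" using z(1) by (simp add: algebra_simps)
  ultimately show thesis using that by blast
qed

lemma renewal_path:
  assumes a: "a \<ge> 1" and inf: "\<And>n. \<exists>k\<ge>n. renewal a e k"
  shows "e n (renewal_path a e n, renewal_path a e (Suc n)) \<ge> (if renewal a e n then a else 1)"
proof -
  let ?Y = "\<lambda>n. {y. e n (renewal_path a e n, y) \<ge> 1 \<and> leads a e (Suc n) y}"
  have Y: "?Y n \<noteq> {}" if "leads a e n (renewal_path a e n)" "\<not> renewal a e n" for n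
    using leads_step[OF a that inf] by blast
  have leads: "leads a e n (renewal_path a e n)" for n
  proof (induction n)
    case 0
    obtain k where "renewal a e k" using inf by blast
    then have "survives e" by (rule renewal_survives[OF a])
    then show ?case using cur_in_cluster[OF a] stack_survives by (force simp: leads_def)
  next
    case (Suc n)
    then show ?case using leads_land[OF a] pick_in[OF Y] by (cases "renewal a e n") auto
  qed
  show ?thesis
  proof (cases "renewal a e n")
    case True
    \<comment> \<open>At \<open>k = n\<close> the invariant speaks of a cluster at time 0, which is
      the origin only; hence the path stands where the search does.\<close>
    then have "renewal_path a e n = cur a e n" using leads[of n] unfolding leads_def by force
    with True show ?thesis using attempt_step[of a e n] by (simp add: renewal_def)
  next
    case False
    then show ?thesis using pick_in[OF Y[OF leads]] by simp
  qed
qed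

subsection \<open>The mass along a path\<close>

lemma infsum_ennreal_ge: "f y \<le> (\<Sum>\<^sub>\<infinity>y. f y)" for f :: "'a \<Rightarrow> ennreal"
proof -
  have "sum f {y} \<le> (SUP F\<in>{F. finite F \<and> F \<subseteq> UNIV}. sum f F)"
    by (rule SUP_upper) simp
  then show ?thesis by (simp add: nonneg_infsum_complete)
qed

text \<open>The sum defining the mass is bounded below by its summand at \<open>\<gamma> n\<close>;
  each time in \<open>R\<close> gains a factor \<open>a\<close>.\<close>

lemma mass_along_path:
  assumes "a \<ge> 1" "\<gamma> 0 = 0"
    and "\<And>n. b (Suc n) (\<gamma> n, \<gamma> (Suc n)) \<ge> (if n \<in> R then a else 1)"
  shows "ennreal (a ^ card {k. k < n \<and> k \<in> R}) \<le> mass b n (\<gamma> n)"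
proof (induction n)
  case 0
  then show ?case using assms by simp
next
  case (Suc n)
  have "{k. k < Suc n \<and> k \<in> R} = (if n \<in> R then insert n else id) {k. k < n \<and> k \<in> R}"
    by (auto simp: less_Suc_eq)
  then have "a ^ card {k. k < Suc n \<and> k \<in> R} =
      a ^ card {k. k < n \<and> k \<in> R} * (if n \<in> R then a else 1)" by simp
  then have "ennreal (a ^ card {k. k < Suc n \<and> k \<in> R}) =
      ennreal (a ^ card {k. k < n \<and> k \<in> R}) * ennreal (if n \<in> R then a else 1)"
    using assms(1) by (simp add: ennreal_mult)
  also have "\<dots> \<le> mass b n (\<gamma> n) * ennreal (b (Suc n) (\<gamma> n, \<gamma> (Suc n)))"
    using Suc assms(3)[of n] by (intro mult_mono ennreal_leI) auto
  also have "\<dots> \<le> mass b (Suc n) (\<gamma> (Suc n))"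
    using infsum_ennreal_ge[of "\<lambda>y. mass b n y * ennreal (b (Suc n) (y, \<gamma> (Suc n)))" "\<gamma> n"] by simp
  finally show ?case .
qed

lemma mass_le_total_mass: "mass b n x \<le> total_mass b n"
  unfolding total_mass_def by (rule infsum_ennreal_ge)

text \<open>A nonzero entry is at least 1, so every step that carries mass is open.\<close>

lemma mass_imp_cluster:
  assumes "\<And>n x y. b (Suc n) (x, y) \<in> {0} \<union> {1..}" "mass b n x \<noteq> 0"
  shows "x \<in> cluster (\<lambda>n. b (Suc n)) n"
  using assms(2)
proof (induction n arbitrary: x)
  case (Suc n)
  then obtain y where "mass b n y * ennreal (b (Suc n) (y, x)) \<noteq> 0"
    using infsum_0[of UNIV "\<lambda>y. mass b n y * ennreal (b (Suc n) (y, x))"] by auto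
  moreover have "b (Suc n) (y, x) = 0 \<or> b (Suc n) (y, x) \<ge> 1" using assms(1)[of n y x] by auto
  ultimately show ?case using Suc.IH[of y] by auto
qed (auto split: if_splits)

lemma total_mass_imp_survives:
  assumes "\<And>n x y. b (Suc n) (x, y) \<in> {0} \<union> {1..}" "\<And>n. total_mass b n \<ge> 1"
  shows "survives (\<lambda>n. b (Suc n))"
  unfolding survives_def
proof
  fix n
  have "\<exists>x. mass b n x \<noteq> 0"
  proof (rule ccontr)
    assume "\<nexists>x. mass b n x \<noteq> 0"
    then have "total_mass b n = 0" unfolding total_mass_def by (intro infsum_0) auto
    then show False using assms(2)[of n] by simp
  qed
  then show "cluster (\<lambda>n. b (Suc n)) n \<noteq> {}" using mass_imp_cluster[of b n] assms(1) by blast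
qed

section \<open>Regeneration\<close>

lemma space_matrix_space [simp]: "space matrix_space = UNIV"
  by (simp add: matrix_space_def space_PiM)

lemma entry_measurable: "(\<lambda>A. A p) \<in> borel_measurable matrix_space"
  unfolding matrix_space_def by (rule measurable_component_singleton) simp

lemma translate_measurable: "translate z \<in> matrix_space \<rightarrow>\<^sub>M matrix_space"
proof -
  have "(\<lambda>A. translate z A p) \<in> borel_measurable matrix_space" for p
    using entry_measurable by (cases p) simp
  then have "translate z \<in> matrix_space \<rightarrow>\<^sub>M (\<Pi>\<^sub>M p\<in>UNIV. borel)"
    by (intro measurable_PiM_single') auto
  then show ?thesis by (simp add: matrix_space_def)
qed

lemma measurable_pick [measurable (raw)]:
  fixes C :: "'a \<Rightarrow> 'c::countable set"
  assumes [measurable]: "\<And>x. Measurable.pred M (\<lambda>w. x \<in> C w)"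
  shows "(\<lambda>w. pick (C w)) \<in> M \<rightarrow>\<^sub>M count_space UNIV"
  unfolding pick_def by measurable

lemma measurable_dropWhile_pred:
  fixes xs :: "'c::countable list"
  assumes "\<And>x. Measurable.pred M (\<lambda>w. Q w x)"
  shows "(\<lambda>w. dropWhile (Q w) xs) \<in> M \<rightarrow>\<^sub>M count_space UNIV"
  using assms by (induction xs) (auto intro!: measurable_If)

locale growth = sequence_space \<mu> for \<mu> :: "('d::finite) matrix measure" +
  assumes sets_mu: "sets \<mu> = sets matrix_space"
    and translate_mu: "\<And>z. distr \<mu> \<mu> (translate z) = \<mu>"
begin

lemma space_mu [simp]: "space \<mu> = UNIV"
  using sets_eq_imp_space_eq[OF sets_mu] by simp

lemma space_S [simp]: "space S = UNIV"
  by (simp add: space_PiM)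

lemma translate_measurable_mu [measurable]: "translate z \<in> \<mu> \<rightarrow>\<^sub>M \<mu>"
  using translate_measurable measurable_cong_sets[OF sets_mu sets_mu] by blast

lemma coordinate_measurable: "(\<lambda>e. e n) \<in> S \<rightarrow>\<^sub>M \<mu>"
  by (rule measurable_component_singleton) simp

lemma entry_measurable_S [measurable]: "(\<lambda>e. e n p) \<in> borel_measurable S"
proof -
  have "(\<lambda>A. A p) \<in> borel_measurable \<mu>"
    using entry_measurable measurable_cong_sets[OF sets_mu refl] by blast
  then show ?thesis using coordinate_measurable by (rule measurable_compose[rotated])
qed

lemma shift_measurable [measurable]: "shift m z \<in> S \<rightarrow>\<^sub>M S"
proof (rule measurable_PiM_single')
  show "(\<lambda>e. shift m z e i) \<in> S \<rightarrow>\<^sub>M \<mu>" for i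
    unfolding shift_def by (rule measurable_compose[OF coordinate_measurable]) simp
qed auto

lemma cluster_measurable [measurable]: "Measurable.pred S (\<lambda>e. y \<in> cluster e n)"
proof (induction n arbitrary: y)
  case (Suc n)
  note [measurable] = Suc
  have "Measurable.pred S (\<lambda>e. \<exists>x. x \<in> cluster e n \<and> e n (x, y) \<ge> 1)" by measurable
  then show ?case by (simp add: Bex_def)
qed simp

lemma cluster_shift_measurable [measurable]: "Measurable.pred S (\<lambda>e. y \<in> cluster (shift m z e) n)"
  by (rule measurable_compose[OF shift_measurable cluster_measurable])

lemma survives_measurable [measurable]: "Measurable.pred S survives"
proof -
  have "Measurable.pred S (\<lambda>e. \<forall>n. \<exists>x. x \<in> cluster e n)" by measurable
  then show ?thesis by (simp add: survives_def ex_in_conv cong: measurable_cong)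
qed

lemma dead_measurable [measurable]: "Measurable.pred S (\<lambda>e. dead e k p)"
proof -
  have "Measurable.pred S (\<lambda>e. \<forall>x. x \<notin> cluster (shift (fst p) (snd p) e) (k - fst p))" by measurable
  then show ?thesis unfolding dead_def by (simp add: all_not_in_conv)
qed

lemma site_of_measurable: "(\<lambda>e. site_of e k s) \<in> S \<rightarrow>\<^sub>M count_space UNIV"
  by (cases s) simp_all

lemma leap_measurable [measurable]: "Measurable.pred S (\<lambda>e. leap a (translate x (e k)))"
  unfolding leap_def by simp

lemma landing_measurable [measurable]:
  "(\<lambda>e. landing a (translate x (e k))) \<in> S \<rightarrow>\<^sub>M count_space UNIV"
  unfolding landing_def by simp

text \<open>Site and stack range over countable types, so they can be frozen at a value and
  reinserted by \<open>measurable_compose_countable\<close>.\<close>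

lemma measurable_stack [measurable]: "(\<lambda>e. stack a e k) \<in> S \<rightarrow>\<^sub>M count_space UNIV"
proof (induction k)
  case (Suc k)
  have push: "(\<lambda>e. push a e k s) \<in> S \<rightarrow>\<^sub>M count_space UNIV" for s
  proof -
    have "(\<lambda>e. if s \<noteq> [] \<and> leap a (translate x (e k))
        then (Suc k, x + landing a (translate x (e k))) # s else s) \<in> S \<rightarrow>\<^sub>M count_space UNIV" for x
      by measurable
    from measurable_compose_countable[OF this site_of_measurable] show ?thesis
      by (simp add: push_def Let_def)
  qed
  have "(\<lambda>e. dropWhile (dead e (Suc k)) s) \<in> S \<rightarrow>\<^sub>M count_space UNIV" for s
    by (rule measurable_dropWhile_pred) (rule dead_measurable)
  from measurable_compose_countable[OF this measurable_compose_countable[OF push Suc]]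
  show ?case by simp
qed simp

lemma cur_measurable [measurable]: "(\<lambda>e. cur a e k) \<in> S \<rightarrow>\<^sub>M count_space UNIV"
  unfolding cur_def by (rule measurable_compose_countable[OF site_of_measurable measurable_stack])

lemma land_measurable [measurable]: "(\<lambda>e. land a e k) \<in> S \<rightarrow>\<^sub>M count_space UNIV"
  unfolding land_def
  by (rule measurable_compose_countable[where f = "\<lambda>x e. x + landing a (translate x (e k))", OF _ cur_measurable])
    measurable

lemma attempt_measurable [measurable]: "Measurable.pred S (\<lambda>e. attempt a e k)"
proof -
  have "Measurable.pred S (\<lambda>e. leap a (translate (cur a e k) (e k)))"
    by (rule measurable_compose_countable[OF leap_measurable cur_measurable])
  then show ?thesis unfolding attempt_def by measurable
qed

lemma shift_land_measurable: "(\<lambda>e. shift (Suc k) (land a e k) e) \<in> S \<rightarrow>\<^sub>M S"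
  by (rule measurable_compose_countable[OF shift_measurable land_measurable])

lemma renewal_measurable [measurable]: "Measurable.pred S (\<lambda>e. renewal a e k)"
  using measurable_compose[OF shift_land_measurable survives_measurable]
  unfolding renewal_def by measurable

lemma renewals_measurable [measurable]: "(\<lambda>e. renewals a e n) \<in> S \<rightarrow>\<^sub>M count_space UNIV"
proof -
  have "(\<lambda>e :: nat \<Rightarrow> 'd matrix. renewals a e n) = (\<lambda>e. \<Sum>k<n. if renewal a e k then 1 else 0)"
    by (auto simp: fun_eq_iff renewals_def sum.If_cases Int_def intro!: arg_cong[where f = card])
  then show ?thesis by (simp only:) measurable
qed

lemma slow_measurable [measurable]: "Measurable.pred S (slow a \<alpha>)"
proof -
  have "Measurable.pred S (\<lambda>e. survives e \<and> (\<forall>K::nat. \<exists>n. real (renewals a e n) + real K < \<alpha> * real n))"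
    by measurable
  then show ?thesis by (simp add: slow_def cong: measurable_cong)
qed

lemma lagging_measurable [measurable]: "Measurable.pred S (lagging a \<alpha> H)"
proof -
  have "Measurable.pred S (\<lambda>e. \<forall>i\<in>{1..H}. \<alpha> * real i \<le> 1 + real (renewals a e (i - 1)))"
    by measurable
  then show ?thesis by (simp add: lagging_def cong: measurable_cong)
qed

lemma lagging_renewal_measurable [measurable]: "Measurable.pred S (\<lambda>e. lagging_renewal a \<alpha> H e k)"
  using measurable_compose[OF shift_land_measurable lagging_measurable]
  unfolding lagging_renewal_def by measurable

lemma leads_measurable [measurable]: "Measurable.pred S (\<lambda>e. leads a e n x)"
proof -
  have "Measurable.pred S (\<lambda>e. cur a e k - x \<in> cluster (shift n x e) (k - n))" for k
    by (rule measurable_compose_countable[where f = "\<lambda>w e. w - x \<in> cluster (shift n x e) (k - n)",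
          OF cluster_shift_measurable cur_measurable])
  then show ?thesis unfolding leads_def by measurable
qed

lemma renewal_path_measurable: "(\<lambda>e. renewal_path a e n) \<in> S \<rightarrow>\<^sub>M count_space UNIV"
proof (induction n)
  case (Suc n)
  have "(\<lambda>e. pick {y. e n (x, y) \<ge> 1 \<and> leads a e (Suc n) y}) \<in> S \<rightarrow>\<^sub>M count_space UNIV" for x
    by measurable
  from measurable_compose_countable[OF this Suc] show ?case by (auto intro!: measurable_If)
qed simp

section \<open>Independence of past and future\<close>

lemma shift_0_preserves: "distr S S (shift 0 z) = S"
proof (rule PiM_eq)
  fix J :: "nat set" and E
  assume J: "finite J" "J \<subseteq> UNIV" "\<And>j. j \<in> J \<Longrightarrow> E j \<in> sets \<mu>"
  have "shift 0 z -` prod_emb UNIV (\<lambda>_. \<mu>) J (\<Pi>\<^sub>E j\<in>J. E j) \<inter> space S =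
      prod_emb UNIV (\<lambda>_. \<mu>) J (\<Pi>\<^sub>E j\<in>J. translate z -` E j)"
    by (auto simp: prod_emb_def shift_def PiE_iff)
  moreover have meas: "translate z -` E j \<in> sets \<mu>" if "j \<in> J" for j
    using measurable_sets[OF translate_measurable_mu J(3)[OF that]] by simp
  ultimately have "emeasure (distr S S (shift 0 z)) (prod_emb UNIV (\<lambda>_. \<mu>) J (\<Pi>\<^sub>E j\<in>J. E j)) =
      (\<Prod>j\<in>J. emeasure \<mu> (translate z -` E j))"
    using J by (subst emeasure_distr) (auto intro!: sets_PiM_I emeasure_PiM_emb)
  also have "\<dots> = (\<Prod>j\<in>J. emeasure \<mu> (E j))"
  proof (rule prod.cong[OF refl])
    fix j assume "j \<in> J"
    then have "emeasure (distr \<mu> \<mu> (translate z)) (E j) = emeasure \<mu> (translate z -` E j)"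
      using J by (subst emeasure_distr) auto
    then show "emeasure \<mu> (translate z -` E j) = emeasure \<mu> (E j)" by (simp add: translate_mu)
  qed
  finally show "emeasure (distr S S (shift 0 z)) (prod_emb UNIV (\<lambda>_. \<mu>) J (\<Pi>\<^sub>E j\<in>J. E j)) =
      (\<Prod>j\<in>J. emeasure \<mu> (E j))" .
qed simp_all

text \<open>Gluing two independent sequences at time \<open>m\<close> by \<open>comb_seq\<close>
  reproduces \<open>S\<close>. Then \<open>C\<close> sees only the first sequence and the shifted
  environment only the second, so the event becomes a rectangle.\<close>

lemma emeasure_past_shift:
  assumes C: "C \<in> sets S" and A: "A \<in> sets S"
    and past: "\<And>e e'. (\<And>j. j < m \<Longrightarrow> e j = e' j) \<Longrightarrow> e \<in> C \<longleftrightarrow> e' \<in> C"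
  shows "emeasure S (C \<inter> shift m z -` A) = emeasure S C * emeasure S A"
proof -
  have sh: "shift n z -` A \<in> sets S" for n
    using measurable_sets[OF shift_measurable A] by simp
  have "emeasure S (C \<inter> shift m z -` A) =
      emeasure (distr (S \<Otimes>\<^sub>M S) S (\<lambda>(\<omega>, \<omega>'). comb_seq m \<omega> \<omega>')) (C \<inter> shift m z -` A)"
    by (simp add: PiM_comb_seq)
  also have "\<dots> = emeasure (S \<Otimes>\<^sub>M S)
      ((\<lambda>(\<omega>, \<omega>'). comb_seq m \<omega> \<omega>') -` (C \<inter> shift m z -` A) \<inter> space (S \<Otimes>\<^sub>M S))"
    using C sh by (intro emeasure_distr measurable_comb_seq) auto
  also have "(\<lambda>(\<omega>, \<omega>'). comb_seq m \<omega> \<omega>') -` (C \<inter> shift m z -` A) \<inter> space (S \<Otimes>\<^sub>M S) =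
      C \<times> (shift 0 z -` A)"
  proof -
    have "comb_seq m e e' \<in> C \<longleftrightarrow> e \<in> C" for e e'
      by (rule past) (simp add: comb_seq_def)
    moreover have "shift m z (comb_seq m e e') = shift 0 z e'" for e e'
      by (simp add: shift_def comb_seq_def)
    ultimately show ?thesis by (auto simp: space_pair_measure)
  qed
  also have "emeasure (S \<Otimes>\<^sub>M S) (C \<times> (shift 0 z -` A)) = emeasure S C * emeasure S (shift 0 z -` A)"
    using C sh by (intro P.emeasure_pair_measure_Times)
  also have "emeasure S (shift 0 z -` A) = emeasure (distr S S (shift 0 z)) A"
    using A by (subst emeasure_distr) auto
  finally show ?thesis by (simp add: shift_0_preserves)
qed

text \<open>The translation may be a random site determined by the past:
  \<open>emeasure_past_shift\<close> applies on each of its countably many values, and the future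
  has the same law from every site.\<close>

lemma measure_past_shift:
  assumes C: "Measurable.pred S C" and A: "A \<in> sets S" and t: "t \<in> S \<rightarrow>\<^sub>M count_space UNIV"
    and past: "\<And>e e'. (\<And>j. j < m \<Longrightarrow> e j = e' j) \<Longrightarrow> C e = C e'"
      "\<And>e e'. (\<And>j. j < m \<Longrightarrow> e j = e' j) \<Longrightarrow> t e = t e'"
  shows "measure S {e. C e \<and> shift m (t e) e \<in> A} = measure S {e. C e} * measure S A"
proof -
  note [measurable] = C t
  define X where "X z = {e. C e \<and> t e = z}" for z
  have X: "X z \<in> sets S" for z
  proof -
    have "{e \<in> space S. C e \<and> t e = z} \<in> sets S" by measurable
    then show ?thesis by (simp add: X_def)
  qed
  have sh: "shift m z -` A \<in> sets S" for z
    using measurable_sets[OF shift_measurable A] by simp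
  have "{e. C e \<and> shift m (t e) e \<in> A} = (\<Union>z. X z \<inter> shift m z -` A)"
    by (auto simp: X_def)
  then have "emeasure S {e. C e \<and> shift m (t e) e \<in> A} =
      (\<integral>\<^sup>+z. emeasure S (X z \<inter> shift m z -` A) \<partial>count_space UNIV)"
    using X sh by (simp only:) (intro emeasure_UN_countable, auto simp: disjoint_family_on_def X_def)
  also have "\<dots> = (\<integral>\<^sup>+z. emeasure S (X z) * emeasure S A \<partial>count_space UNIV)"
  proof (rule nn_integral_cong)
    fix z
    show "emeasure S (X z \<inter> shift m z -` A) = emeasure S (X z) * emeasure S A"
    proof (rule emeasure_past_shift[OF X A])
      fix e e' :: "nat \<Rightarrow> 'd matrix" assume "\<And>j. j < m \<Longrightarrow> e j = e' j"
      from past[OF this] show "e \<in> X z \<longleftrightarrow> e' \<in> X z" by (simp add: X_def)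
    qed
  qed
  also have "\<dots> = (\<integral>\<^sup>+z. emeasure S (X z) \<partial>count_space UNIV) * emeasure S A"
    by (rule nn_integral_multc) simp
  also have "(\<integral>\<^sup>+z. emeasure S (X z) \<partial>count_space UNIV) = emeasure S (\<Union>z. X z)"
    using X by (intro emeasure_UN_countable[symmetric]) (auto simp: disjoint_family_on_def X_def)
  also have "(\<Union>z. X z) = {e. C e}" by (auto simp: X_def)
  finally show ?thesis by (simp add: measure_def enn2real_mult)
qed

text \<open>The \<open>q\<close> of the overview; \<open>survival_prob\<close> below is its
  \<rho>.\<close>

definition leap_prob :: "real \<Rightarrow> real" where
  "leap_prob a = measure S {e. leap a (e 0)}"

definition survival_prob :: real where
  "survival_prob = measure S {e. survives e}"

lemma sets_Collect_S: "Measurable.pred S Q \<Longrightarrow> {e. Q e} \<in> sets S"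
  by (simp add: pred_def)

text \<open>Past and future are separated twice: at time \<open>k\<close> the row of
  \<open>cur a e k\<close> is fresh, and at time \<open>Suc k\<close> the environment seen from
  \<open>land a e k\<close> is.\<close>

lemma measure_attempt_shift:
  assumes "A \<in> sets S"
  shows "measure S {e. attempt a e k \<and> shift (Suc k) (land a e k) e \<in> A} =
    measure S {e. stack a e k \<noteq> []} * leap_prob a * measure S A"
proof -
  have leap: "{e. leap a (e 0)} \<in> sets S"
    using leap_measurable[of a 0 0] by (intro sets_Collect_S) simp
  have "measure S {e. attempt a e k} =
      measure S {e. stack a e k \<noteq> [] \<and> shift k (cur a e k) e \<in> {e. leap a (e 0)}}"
    by (auto simp: attempt_def shift_def intro!: arg_cong[where f = "measure S"])
  also have "\<dots> = measure S {e. stack a e k \<noteq> []} * leap_prob a"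
    unfolding leap_prob_def
  proof (rule measure_past_shift[OF _ leap cur_measurable])
    show "Measurable.pred S (\<lambda>e. stack a e k \<noteq> [])" by measurable
    fix e e' :: "nat \<Rightarrow> 'd matrix" assume "\<And>j. j < k \<Longrightarrow> e j = e' j"
    then show "stack a e k \<noteq> [] \<longleftrightarrow> stack a e' k \<noteq> []" "cur a e k = cur a e' k"
      using stack_cong[of k e e' a] cur_cong[of k e e' a] by simp_all
  qed
  finally have "measure S {e. attempt a e k} = measure S {e. stack a e k \<noteq> []} * leap_prob a" .
  moreover have "measure S {e. attempt a e k \<and> shift (Suc k) (land a e k) e \<in> A} =
      measure S {e. attempt a e k} * measure S A"
    using attempt_land_cong by (rule measure_past_shift[OF attempt_measurable assms land_measurable])
  ultimately show ?thesis by simp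
qed

text \<open>A slow environment at the landing site survives, which turns the attempt into a renewal,
  and by \<open>slow_shift\<close> it makes \<open>e\<close> slow too. The factor
  \<open>survival_prob\<close> appears because the stack is nonempty on survival.\<close>

lemma renewal_slow_prob:
  assumes "a \<ge> 1" "\<alpha> \<ge> 0"
  shows "survival_prob * leap_prob a * measure S {e. slow a \<alpha> e} \<le> measure S {e. slow a \<alpha> e \<and> renewal a e k}"
proof -
  have slow: "{e. slow a \<alpha> e} \<in> sets S" by (intro sets_Collect_S slow_measurable)
  have "survival_prob \<le> measure S {e. stack a e k \<noteq> []}"
    unfolding survival_prob_def using stack_survives
    by (intro P.finite_measure_mono sets_Collect_S) (blast, measurable)
  then have "survival_prob * leap_prob a * measure S {e. slow a \<alpha> e}
      \<le> measure S {e. stack a e k \<noteq> []} * leap_prob a * measure S {e. slow a \<alpha> e}"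
    by (intro mult_right_mono) (auto simp: leap_prob_def)
  also have "\<dots> = measure S {e. attempt a e k \<and> shift (Suc k) (land a e k) e \<in> {e. slow a \<alpha> e}}"
    using measure_attempt_shift[OF slow] by simp
  also have "\<dots> \<le> measure S {e. slow a \<alpha> e \<and> renewal a e k}"
  proof (rule P.finite_measure_mono)
    show "{e. slow a \<alpha> e \<and> renewal a e k} \<in> sets S"
      by (intro sets_Collect_S) measurable
    show "{e. attempt a e k \<and> shift (Suc k) (land a e k) e \<in> {e. slow a \<alpha> e}} \<subseteq> {e. slow a \<alpha> e \<and> renewal a e k}"
      using slow_shift[OF assms] by (auto simp: renewal_def slow_def)
  qed
  finally show ?thesis .
qed

text \<open>By the same factorization: at a lagging renewal of a slow environment the landing site
  sees an environment that is slow and lagging, an event whose probability does not depend on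
  \<open>k\<close>.\<close>

lemma lagging_renewal_slow_prob:
  assumes "a \<ge> 1" "\<alpha> \<ge> 0"
  shows "measure S {e. slow a \<alpha> e \<and> lagging_renewal a \<alpha> H e k} \<le> measure S {e. slow a \<alpha> e \<and> lagging a \<alpha> H e}"
proof -
  let ?A = "{e. slow a \<alpha> e \<and> lagging a \<alpha> H e}"
  have A: "?A \<in> sets S" by (intro sets_Collect_S) measurable
  have "measure S {e. slow a \<alpha> e \<and> lagging_renewal a \<alpha> H e k}
      \<le> measure S {e. attempt a e k \<and> shift (Suc k) (land a e k) e \<in> ?A}"
  proof (rule P.finite_measure_mono)
    have "Measurable.pred S (\<lambda>e. slow a \<alpha> e \<and> lagging a \<alpha> H e)" by measurable
    note [measurable] = measurable_compose[OF shift_land_measurable this]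
    show "{e. attempt a e k \<and> shift (Suc k) (land a e k) e \<in> ?A} \<in> sets S"
      unfolding mem_Collect_eq by (intro sets_Collect_S) measurable
    show "{e. slow a \<alpha> e \<and> lagging_renewal a \<alpha> H e k} \<subseteq>
        {e. attempt a e k \<and> shift (Suc k) (land a e k) e \<in> ?A}"
      using slow_shift[OF assms] by (auto simp: lagging_renewal_def renewal_def)
  qed
  also have "\<dots> = measure S {e. stack a e k \<noteq> []} * leap_prob a * measure S ?A"
    by (rule measure_attempt_shift[OF A])
  also have "\<dots> \<le> 1 * 1 * measure S ?A"
    unfolding leap_prob_def by (intro mult_right_mono mult_mono) auto
  finally show ?thesis by simp
qed

lemma slow_null:
  assumes "a \<ge> 1" "0 \<le> \<alpha>" "\<alpha> < survival_prob * leap_prob a"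
  shows "measure S {e. slow a \<alpha> e} = 0"
proof -
  define c where "c = survival_prob * leap_prob a"
  define A where "A = {e :: nat \<Rightarrow> 'd matrix. slow a \<alpha> e}"
  define p d where "p = measure S A" and "d H = measure S {e. slow a \<alpha> e \<and> lagging a \<alpha> H e}" for H
  have A: "A \<in> sets S" unfolding A_def by (intro sets_Collect_S slow_measurable)
  \<comment> \<open>The expected number of renewals before \<open>n\<close> on the slow event is at
    least \<open>c * p * n\<close>, and by integrating \<open>renewals_le_lagging\<close> at most
    \<open>\<alpha> * p * n + d H * n + H\<close>.\<close>
  have key: "(c - \<alpha>) * p * real n \<le> d H * real n + real H" for n H
  proof -
    let ?R = "\<lambda>k. {e. slow a \<alpha> e \<and> renewal a e k}"
    let ?D = "\<lambda>k. {e. slow a \<alpha> e \<and> lagging_renewal a \<alpha> H e k}"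
    have sets: "?R k \<in> sets S" "?D k \<in> sets S" for k
      by (intro sets_Collect_S; measurable)+
    have card: "(\<Sum>k<n. indicator {e. Q e k} e) = real (card {k. k < n \<and> Q e k})"
      for Q :: "(nat \<Rightarrow> 'd matrix) \<Rightarrow> nat \<Rightarrow> bool" and e
      by (simp add: indicator_def sum.If_cases Int_def)
    have "real n * (c * p) = (\<Sum>k<n. c * p)" by simp
    also have "\<dots> \<le> (\<Sum>k<n. measure S (?R k))"
      unfolding c_def p_def A_def by (intro sum_mono renewal_slow_prob assms)
    also have "\<dots> = (\<integral>e. (\<Sum>k<n. indicator (?R k) e) \<partial>S)"
      using sets by (subst Bochner_Integration.integral_sum) (auto simp: P.emeasure_eq_measure)
    also have "\<dots> \<le> (\<integral>e. \<alpha> * real n * indicator A e + (\<Sum>k<n. indicator (?D k) e) + real H \<partial>S)"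
    proof (rule integral_mono)
      show "integrable S (\<lambda>e. \<Sum>k<n. indicator (?R k) e :: real)"
        using sets by (auto simp: P.emeasure_eq_measure)
      show "integrable S (\<lambda>e. \<alpha> * real n * indicator A e + (\<Sum>k<n. indicator (?D k) e) + real H)"
        using sets A by (auto simp: P.emeasure_eq_measure)
      fix e :: "nat \<Rightarrow> 'd matrix"
      show "(\<Sum>k<n. indicator (?R k) e) \<le> \<alpha> * real n * indicator A e + (\<Sum>k<n. indicator (?D k) e) + real H"
        using renewals_le_lagging[OF assms(2), of a e n H]
        by (cases "slow a \<alpha> e") (simp_all add: A_def card renewals_def)
    qed
    also have "\<dots> = \<alpha> * real n * p + (\<Sum>k<n. measure S (?D k)) + real H"
      using sets A using P.prob_space by (simp add: P.emeasure_eq_measure p_def)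
    also have "\<dots> \<le> \<alpha> * real n * p + (\<Sum>k<n. d H) + real H"
      unfolding d_def by (intro add_mono sum_mono lagging_renewal_slow_prob assms order_refl)
    finally show ?thesis by (simp add: algebra_simps)
  qed
  \<comment> \<open>Division by \<open>n\<close> and the limit in \<open>n\<close> with
    \<open>H\<close> fixed remove the boundary term.\<close>
  have le: "(c - \<alpha>) * p \<le> d H" for H
  proof -
    have "(\<lambda>n. d H + real H / real (Suc n)) \<longlonglongrightarrow> d H + 0"
      using LIMSEQ_Suc[OF lim_const_over_n[of "real H"]] by (intro tendsto_intros) auto
    moreover have "(c - \<alpha>) * p \<le> d H + real H / real (Suc n)" for n
      using key[of "Suc n" H] by (simp add: field_simps)
    ultimately show ?thesis using LIMSEQ_le_const[of "\<lambda>n. d H + real H / real (Suc n)" "d H" "(c - \<alpha>) * p"]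
      by auto
  qed
  \<comment> \<open>As \<open>H\<close> grows the events decrease to the empty set, since each slow
    environment fails to lag for some \<open>H\<close>.\<close>
  have "d \<longlonglongrightarrow> measure S (\<Inter>H. {e. slow a \<alpha> e \<and> lagging a \<alpha> H e})"
    unfolding d_def
  proof (rule P.finite_Lim_measure_decseq)
    show "range (\<lambda>H. {e. slow a \<alpha> e \<and> lagging a \<alpha> H e}) \<subseteq> sets S"
      by (intro image_subsetI sets_Collect_S) measurable
    show "decseq (\<lambda>H. {e. slow a \<alpha> e \<and> lagging a \<alpha> H e})"
      by (auto simp: decseq_def lagging_def)
  qed
  moreover have "(\<Inter>H. {e :: nat \<Rightarrow> 'd matrix. slow a \<alpha> e \<and> lagging a \<alpha> H e}) = {}"
  proof (rule equals0I)
    fix e :: "nat \<Rightarrow> 'd matrix"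
    assume e: "e \<in> (\<Inter>H. {e. slow a \<alpha> e \<and> lagging a \<alpha> H e})"
    then have "slow a \<alpha> e" by blast
    then obtain H where "\<not> lagging a \<alpha> H e" by (rule slow_imp_not_lagging)
    with e show False by blast
  qed
  ultimately have "d \<longlonglongrightarrow> 0" by simp
  then have "(c - \<alpha>) * p \<le> 0" using le by (intro LIMSEQ_le_const) auto
  moreover have "c - \<alpha> > 0" "p \<ge> 0" using assms by (auto simp: c_def p_def)
  ultimately have "p = 0" by (auto simp: mult_le_0_iff)
  then show ?thesis by (simp add: p_def A_def)
qed

lemma AE_renewal_frequency:
  assumes "a \<ge> 1" "survival_prob * leap_prob a > 0"
  shows "AE e in S. survives e \<longrightarrow>
    (\<forall>\<alpha> < survival_prob * leap_prob a. \<exists>K::nat. \<forall>n. \<alpha> * real n \<le> real (renewals a e n) + real K)"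
proof -
  let ?c = "survival_prob * leap_prob a"
  \<comment> \<open>These rates start at 0, so all are admissible in \<open>slow_null\<close>, and
    increase to \<open>?c\<close>; countably many null events thus handle every rate below
    \<open>?c\<close>.\<close>
  let ?\<alpha> = "\<lambda>j. ?c - ?c / real (Suc j)"
  have "AE e in S. \<not> slow a (?\<alpha> j) e" for j :: nat
  proof -
    have "?c / real (Suc j) \<le> ?c / 1" using assms by (intro divide_left_mono) auto
    then have "measure S {e. slow a (?\<alpha> j) e} = 0"
      using assms by (intro slow_null) auto
    then show ?thesis
      by (subst AE_iff_measurable[OF _ refl]) (auto simp: P.emeasure_eq_measure intro: sets_Collect_S slow_measurable)
  qed
  then have "AE e in S. \<forall>j. \<not> slow a (?\<alpha> j) e" by (subst AE_all_countable) blast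
  then show ?thesis
  proof eventually_elim
    case (elim e)
    show ?case
    proof (intro impI allI)
      fix \<alpha> assume "survives e" "\<alpha> < ?c"
      have "(\<lambda>j. ?\<alpha> j) \<longlonglongrightarrow> ?c - 0"
        using LIMSEQ_Suc[OF lim_const_over_n[of ?c]] by (intro tendsto_intros) auto
      then have "\<forall>\<^sub>F j in sequentially. \<alpha> < ?\<alpha> j" using \<open>\<alpha> < ?c\<close> by (intro order_tendstoD) auto
      then obtain j where j: "\<alpha> < ?\<alpha> j" by (auto simp: eventually_sequentially)
      obtain K :: nat where "\<forall>n. ?\<alpha> j * real n \<le> real (renewals a e n) + real K"
        using elim \<open>survives e\<close> unfolding slow_def not_less[symmetric] by blast
      moreover have "\<alpha> * real n \<le> ?\<alpha> j * real n" for n using j by (intro mult_right_mono) auto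
      ultimately show "\<exists>K::nat. \<forall>n. \<alpha> * real n \<le> real (renewals a e n) + real K"
        using order_trans by blast
    qed
  qed
qed

end

section \<open>Growth of the mass along the renewal path\<close>

lemma eln_mono: "u \<le> v \<Longrightarrow> eln u \<le> eln v"
  by (cases u; cases v) (auto simp: eln_def ennreal_eq_0_iff top_unique)

lemma eln_ennreal: "r > 0 \<Longrightarrow> eln (ennreal r) = ereal (ln r)"
  by (simp add: eln_def ennreal_eq_0_iff)

lemma renewal_path_growth:
  fixes b :: "nat \<Rightarrow> ('d::finite) matrix"
  defines "e \<equiv> \<lambda>n. b (Suc n)"
  assumes a: "a \<ge> 1" and c: "c > 0"
    and freq: "\<And>\<alpha>. \<alpha> < c \<Longrightarrow> \<exists>K::nat. \<forall>n. \<alpha> * real n \<le> real (renewals a e n) + real K"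
  shows "open_path b (renewal_path a e)"
    and "ereal (c * ln a) \<le> liminf (\<lambda>n. ereal (1 / real n) * eln (mass b n (renewal_path a e n)))"
proof -
  \<comment> \<open>A positive frequency, here the rate \<open>c / 2\<close>, excludes a last
    renewal; the path needs one to head for at every time.\<close>
  have inf: "\<exists>k\<ge>n. renewal a e k" for n
  proof (rule ccontr)
    assume no: "\<not> (\<exists>k\<ge>n. renewal a e k)"
    have "renewals a e m \<le> n" for m
    proof -
      have "renewals a e m \<le> card {..<n}"
        unfolding renewals_def using no by (intro card_mono) (auto simp: not_le)
      then show ?thesis by simp
    qed
    moreover obtain K :: nat where K: "\<And>m. c / 2 * real m \<le> real (renewals a e m) + real K"
      using freq[of "c / 2"] c by auto
    ultimately have "c / 2 * real m \<le> real (n + K)" for m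
      by (metis K add_right_mono of_nat_add of_nat_le_iff order_trans)
    moreover obtain m :: nat where "real (n + K) < c / 2 * real m"
      using reals_Archimedean3[of "c / 2"] c by (metis half_gt_zero mult.commute)
    ultimately show False using not_le by blast
  qed
  note step = renewal_path[OF a inf]
  show "open_path b (renewal_path a e)"
    unfolding open_path_def
  proof
    fix n
    show "b (Suc n) (renewal_path a e n, renewal_path a e (Suc n)) \<ge> 1"
      using step[of n] a unfolding e_def by (auto split: if_splits)
  qed
  have mass: "ennreal (a ^ renewals a e n) \<le> mass b n (renewal_path a e n)" for n
    unfolding renewals_def
    using mass_along_path[where b = b and R = "{k. renewal a e k}" and \<gamma> = "renewal_path a e", OF a] step
    by (simp add: e_def)
  have lower: "ereal (real (renewals a e n) / real n * ln a)
      \<le> ereal (1 / real n) * eln (mass b n (renewal_path a e n))" for n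
  proof -
    have "eln (ennreal (a ^ renewals a e n)) = ereal (real (renewals a e n) * ln a)"
      using a by (simp add: eln_ennreal ln_realpow)
    then have "ereal (real (renewals a e n) * ln a) \<le> eln (mass b n (renewal_path a e n))"
      using eln_mono[OF mass] by metis
    then have "ereal (1 / real n) * ereal (real (renewals a e n) * ln a)
        \<le> ereal (1 / real n) * eln (mass b n (renewal_path a e n))"
      by (intro ereal_mult_left_mono) auto
    then show ?thesis by simp
  qed
  \<comment> \<open>The bounded deficit \<open>K\<close> vanishes after division by
    \<open>n\<close>, giving every rate below \<open>c\<close>; the rate \<open>c\<close> itself
    then follows in the limit.\<close>
  have le: "ereal (\<alpha> * ln a) \<le> liminf (\<lambda>n. ereal (1 / real n) * eln (mass b n (renewal_path a e n)))"
    if \<alpha>: "\<alpha> < c" for \<alpha>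
  proof -
    obtain K :: nat where K: "\<And>n. \<alpha> * real n \<le> real (renewals a e n) + real K" using freq[OF \<alpha>] by auto
    have "(\<lambda>n. (\<alpha> - real K / real n) * ln a) \<longlonglongrightarrow> (\<alpha> - 0) * ln a"
      by (intro tendsto_intros lim_const_over_n)
    then have "(\<lambda>n. ereal ((\<alpha> - real K / real n) * ln a)) \<longlonglongrightarrow> ereal (\<alpha> * ln a)" by simp
    then have "ereal (\<alpha> * ln a) = liminf (\<lambda>n. ereal ((\<alpha> - real K / real n) * ln a))"
      by (intro lim_imp_Liminf[symmetric]) auto
    also have "\<dots> \<le> liminf (\<lambda>n. ereal (1 / real n) * eln (mass b n (renewal_path a e n)))"
    proof (rule Liminf_mono)
      show "\<forall>\<^sub>F n in sequentially. ereal ((\<alpha> - real K / real n) * ln a)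
          \<le> ereal (1 / real n) * eln (mass b n (renewal_path a e n))"
        using eventually_gt_at_top[of "0::nat"]
      proof eventually_elim
        case (elim n)
        have "\<alpha> - real K / real n \<le> real (renewals a e n) / real n"
          using divide_right_mono[of "\<alpha> * real n - real K" "real (renewals a e n)" "real n"] K[of n] elim
          by (simp add: diff_divide_distrib)
        then have "(\<alpha> - real K / real n) * ln a \<le> real (renewals a e n) / real n * ln a"
          using a by (intro mult_right_mono) auto
        then show ?case using lower[of n] by (meson ereal_less_eq(3) order_trans)
      qed
    qed
    finally show ?thesis .
  qed
  have "(\<lambda>j. (c - 1 / real (Suc j)) * ln a) \<longlonglongrightarrow> (c - 0) * ln a"
    using LIMSEQ_Suc[OF lim_const_over_n[of 1]] by (intro tendsto_intros) auto
  then have "(\<lambda>j. ereal ((c - 1 / real (Suc j)) * ln a)) \<longlonglongrightarrow> ereal (c * ln a)" by simp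
  then show "ereal (c * ln a) \<le> liminf (\<lambda>n. ereal (1 / real n) * eln (mass b n (renewal_path a e n)))"
    by (rule LIMSEQ_le_const2) (use le in auto)
qed

section \<open>Transfer to the given copies\<close>

lemma entries_measurable:
  "Measurable.pred matrix_space (\<lambda>A. \<forall>x y. A (x, y) \<in> {0} \<union> {1..})"
proof -
  note [measurable] = entry_measurable
  show ?thesis by measurable
qed

locale copies = Pr: prob_space P for P :: "'a measure" and Bs :: "nat \<Rightarrow> 'a \<Rightarrow> ('d::finite) matrix" and \<mu> +
  assumes indep: "Pr.indep_vars (\<lambda>_. matrix_space) Bs {1..}"
    and law: "\<And>n. n \<ge> 1 \<Longrightarrow> distr P matrix_space (Bs n) = \<mu>"
    and law_invariant: "\<And>z. distr \<mu> matrix_space (translate z) = \<mu>"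
    and law_entries: "AE A in \<mu>. \<forall>x y. A (x, y) \<in> {0} \<union> {1..}"
begin

lemma copy_measurable: "n \<ge> 1 \<Longrightarrow> Bs n \<in> P \<rightarrow>\<^sub>M matrix_space"
  using indep by (auto simp: Pr.indep_vars_def)

lemma sets_law: "sets \<mu> = sets matrix_space"
  using law[of 1] by auto

lemma prob_space_law: "prob_space \<mu>"
  using Pr.prob_space_distr[OF copy_measurable[of 1]] law[of 1] by simp

sublocale growth \<mu>
proof -
  interpret product_prob_space "\<lambda>_::nat. \<mu>" UNIV
    by (rule product_prob_spaceI) (rule prob_space_law)
  have "distr \<mu> \<mu> (translate z) = \<mu>" for z
    using law_invariant[of z] distr_cong[OF refl sets_law, of \<mu> "translate z" "translate z"] by simp
  then show "growth \<mu>" by unfold_locales (auto simp: sets_law)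
qed

text \<open>Mediates between two numberings: the matrices start at index 1 in
  \<open>total_mass\<close>, at 0 in \<open>S\<close>.\<close>

definition tail :: "(nat \<Rightarrow> 'd matrix) \<Rightarrow> nat \<Rightarrow> 'd matrix" where
  "tail b = (\<lambda>n. b (Suc n))"

abbreviation "Q \<equiv> \<Pi>\<^sub>M n\<in>{1::nat..}. \<mu>"

lemma tail_measurable: "tail \<in> Q \<rightarrow>\<^sub>M S"
  unfolding tail_def by (rule measurable_PiM_single') (auto simp: space_PiM PiE_iff)

lemma distr_tail: "distr Q S tail = S"
  using distr_PiM_reindex[of "{1..}" "\<lambda>_. \<mu>" Suc UNIV] prob_space_law
  by (auto simp: tail_def[abs_def] restrict_def)

text \<open>Independence and equal laws give the copies, restricted to positive indices, the law
  \<open>Q\<close>; \<open>tail\<close> carries this over to \<open>S\<close>.\<close>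

lemma distr_copies: "distr P S (\<lambda>\<omega> n. Bs (Suc n) \<omega>) = S"
proof -
  have PiM: "(\<Pi>\<^sub>M n\<in>{1::nat..}. distr P matrix_space (Bs n)) = Q"
    using law by (intro PiM_cong) auto
  have sets: "sets (\<Pi>\<^sub>M n\<in>{1::nat..}. matrix_space) = sets Q"
    using sets_law by (intro sets_PiM_cong) auto
  have meas: "(\<lambda>\<omega>. \<lambda>n\<in>{1..}. Bs n \<omega>) \<in> P \<rightarrow>\<^sub>M Q"
    unfolding measurable_cong_sets[OF refl sets[symmetric]]
    by (rule measurable_restrict) (auto intro: copy_measurable)
  have "distr P (\<Pi>\<^sub>M n\<in>{1::nat..}. matrix_space) (\<lambda>\<omega>. \<lambda>n\<in>{1..}. Bs n \<omega>) = Q"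
    using Pr.indep_vars_iff_distr_eq_PiM'[of "{1..}" Bs "\<lambda>_. matrix_space"] indep copy_measurable PiM
    by auto
  then have "distr P Q (\<lambda>\<omega>. \<lambda>n\<in>{1..}. Bs n \<omega>) = Q"
    using distr_cong[OF refl sets] by metis
  then have "S = distr (distr P Q (\<lambda>\<omega>. \<lambda>n\<in>{1..}. Bs n \<omega>)) S tail"
    by (simp only: distr_tail)
  also have "\<dots> = distr P S (\<lambda>\<omega> n. Bs (Suc n) \<omega>)"
    by (subst distr_distr[OF tail_measurable meas]) (simp add: comp_def tail_def)
  finally show ?thesis by simp
qed

lemma copies_measurable: "(\<lambda>\<omega> n. Bs (Suc n) \<omega>) \<in> P \<rightarrow>\<^sub>M S"
proof (rule measurable_PiM_single')
  show "Bs (Suc n) \<in> P \<rightarrow>\<^sub>M \<mu>" for n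
    using copy_measurable[of "Suc n"] measurable_cong_sets[OF refl sets_law] by auto
qed auto

lemma AE_copies_entries: "AE \<omega> in P. \<forall>n x y. Bs (Suc n) \<omega> (x, y) \<in> {0} \<union> {1..}"
proof -
  have "AE \<omega> in P. \<forall>x y. Bs (Suc n) \<omega> (x, y) \<in> {0} \<union> {1..}" for n
    using law_entries entries_measurable unfolding law[of "Suc n", symmetric, simplified]
    by (subst (asm) AE_distr_iff[OF copy_measurable]) (auto simp: pred_def)
  then show ?thesis by (subst AE_all_countable) blast
qed

text \<open>Almost surely all entries lie in \<open>{0} \<union> {1..}\<close>, and then persistent
  mass means a persistent cluster.\<close>

lemma total_mass_prob: "measure Q {b \<in> space Q. \<forall>n. total_mass b n \<ge> 1} \<le> survival_prob"
proof -
  interpret Q: prob_space Q by (rule prob_space_PiM) (rule prob_space_law)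
  let ?X = "{b \<in> space Q. survives (tail b)}"
  have X: "?X \<in> sets Q"
    using measurable_compose[OF tail_measurable survives_measurable] by (simp add: pred_def)
  have "AE b in Q. \<forall>x y. b (Suc n) (x, y) \<in> {0} \<union> {1..}" for n
    by (rule AE_PiM_component) (auto intro: prob_space_law simp: law_entries[simplified])
  then have "AE b in Q. \<forall>n x y. b (Suc n) (x, y) \<in> {0} \<union> {1..}" by (subst AE_all_countable) blast
  then have "AE b in Q. b \<in> {b \<in> space Q. \<forall>n. total_mass b n \<ge> 1} \<longrightarrow> b \<in> ?X"
    by eventually_elim (use total_mass_imp_survives in \<open>auto simp: tail_def\<close>)
  then have "measure Q {b \<in> space Q. \<forall>n. total_mass b n \<ge> 1} \<le> measure Q ?X"
    using X by (rule Q.finite_measure_mono_AE)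
  also have "\<dots> = measure (distr Q S tail) {e. survives e}"
    by (subst measure_distr[OF tail_measurable])
      (auto intro!: sets_Collect_S arg_cong[where f = "measure _"])
  finally show ?thesis unfolding distr_tail survival_prob_def .
qed

lemma entry_prob: "measure P {\<omega> \<in> space P. Bs 1 \<omega> (0, x) \<ge> a} \<le> leap_prob a"
proof -
  let ?X = "{e. e 0 (0, x) \<ge> a}"
  have X: "?X \<in> sets S" by (intro sets_Collect_S) measurable
  have "measure P {\<omega> \<in> space P. Bs 1 \<omega> (0, x) \<ge> a} = measure (distr P S (\<lambda>\<omega> n. Bs (Suc n) \<omega>)) ?X"
    using X by (subst measure_distr[OF copies_measurable]) (auto intro!: arg_cong[where f = "measure P"])
  also have "\<dots> \<le> leap_prob a"
    unfolding distr_copies leap_prob_def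
    using leap_measurable[of a 0 0]
    by (intro P.finite_measure_mono sets_Collect_S) (auto simp: leap_def)
  finally show ?thesis .
qed

text \<open>One large entry in a fixed place is already a leap, so the supremum over places is at
  most \<open>leap_prob (1 + \<delta>)\<close>.\<close>

lemma c_const_le: "c_const \<delta> P (Bs 1) \<le> survival_prob * leap_prob (1 + \<delta>)"
proof -
  let ?f = "\<lambda>x. measure P {\<omega> \<in> space P. Bs 1 \<omega> (0, x) \<ge> 1 + \<delta>}"
  have "0 \<le> ?f 0" by simp
  also have "?f 0 \<le> (SUP x. ?f x)"
    by (rule cSUP_upper) (auto intro!: bdd_aboveI[where M = 1])
  finally have "0 \<le> (SUP x. ?f x)" .
  moreover have "(SUP x. ?f x) \<le> leap_prob (1 + \<delta>)"
    by (rule cSUP_least) (simp, rule entry_prob)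
  ultimately show ?thesis
    unfolding c_const_def Let_def law[OF order_refl] using total_mass_prob
    by (intro mult_mono) (auto simp: survival_prob_def)
qed

lemma growth_along_path:
  assumes "a \<ge> 1" "survival_prob * leap_prob a > 0"
  shows "\<exists>\<Gamma> :: nat \<Rightarrow> 'a \<Rightarrow> 'd site.
    (\<forall>n. \<Gamma> n \<in> P \<rightarrow>\<^sub>M count_space UNIV) \<and>
    (AE \<omega> in P. (\<forall>n. total_mass (\<lambda>k. Bs k \<omega>) n \<ge> 1) \<longrightarrow>
       open_path (\<lambda>k. Bs k \<omega>) (\<lambda>n. \<Gamma> n \<omega>) \<and>
       ereal (survival_prob * leap_prob a * ln a)
         \<le> liminf (\<lambda>n. ereal (1 / real n) * eln (mass (\<lambda>k. Bs k \<omega>) n (\<Gamma> n \<omega>))))"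
proof (intro exI conjI allI)
  let ?\<Gamma> = "\<lambda>n \<omega>. renewal_path a (\<lambda>n. Bs (Suc n) \<omega>) n"
  show "?\<Gamma> n \<in> P \<rightarrow>\<^sub>M count_space UNIV" for n
    by (rule measurable_compose[OF copies_measurable renewal_path_measurable])
  have "AE e in distr P S (\<lambda>\<omega> n. Bs (Suc n) \<omega>). survives e \<longrightarrow>
      (\<forall>\<alpha> < survival_prob * leap_prob a. \<exists>K::nat. \<forall>n. \<alpha> * real n \<le> real (renewals a e n) + real K)"
    unfolding distr_copies by (rule AE_renewal_frequency[OF assms])
  from AE_distrD[OF copies_measurable this] AE_copies_entries
  show "AE \<omega> in P. (\<forall>n. total_mass (\<lambda>k. Bs k \<omega>) n \<ge> 1) \<longrightarrow>
       open_path (\<lambda>k. Bs k \<omega>) (\<lambda>n. ?\<Gamma> n \<omega>) \<and>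
       ereal (survival_prob * leap_prob a * ln a)
         \<le> liminf (\<lambda>n. ereal (1 / real n) * eln (mass (\<lambda>k. Bs k \<omega>) n (?\<Gamma> n \<omega>)))"
  proof eventually_elim
    case (elim \<omega>)
    show ?case
    proof
      assume "\<forall>n. total_mass (\<lambda>k. Bs k \<omega>) n \<ge> 1"
      then have "survives (\<lambda>n. Bs (Suc n) \<omega>)"
        using elim(2) total_mass_imp_survives[of "\<lambda>k. Bs k \<omega>"] by blast
      then show "open_path (\<lambda>k. Bs k \<omega>) (\<lambda>n. ?\<Gamma> n \<omega>) \<and>
       ereal (survival_prob * leap_prob a * ln a)
         \<le> liminf (\<lambda>n. ereal (1 / real n) * eln (mass (\<lambda>k. Bs k \<omega>) n (?\<Gamma> n \<omega>)))"
        using elim(1) renewal_path_growth[OF assms, of "\<lambda>k. Bs k \<omega>"] by auto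
    qed
  qed
qed

lemma leap_prob_mono: "a \<le> a' \<Longrightarrow> leap_prob a' \<le> leap_prob a"
  unfolding leap_prob_def
  using leap_measurable[of a 0 0]
  by (intro P.finite_measure_mono sets_Collect_S) (auto simp: leap_def intro: order_trans)

end

theorem theorem1p2:
  fixes N :: "'b measure" and B :: "'b \<Rightarrow> ('d::finite) matrix"
    and P :: "'a measure" and Bs :: "nat \<Rightarrow> 'a \<Rightarrow> 'd matrix"
    and \<delta> :: real
  assumes "prob_space N" and "random_matrix N B" and "translation_invariant N B"
    and "prob_space P" and "independent_copies P Bs N B"
    and "\<delta> > 0" and "c_const \<delta> P (Bs 1) > 0"
  shows
    "(\<forall>\<epsilon>. 0 < \<epsilon> \<and> \<epsilon> < \<delta> \<longrightarrow>
       (\<exists>\<Gamma> :: nat \<Rightarrow> 'a \<Rightarrow> 'd site.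
          (\<forall>n. \<Gamma> n \<in> P \<rightarrow>\<^sub>M count_space UNIV) \<and>
          (AE \<omega> in P.
             (\<forall>n. total_mass (\<lambda>k. Bs k \<omega>) n \<ge> 1) \<longrightarrow>
               open_path (\<lambda>k. Bs k \<omega>) (\<lambda>n. \<Gamma> n \<omega>) \<and>
               liminf (\<lambda>n. ereal (1 / real n) * eln (mass (\<lambda>k. Bs k \<omega>) n (\<Gamma> n \<omega>)))
                 \<ge> ereal (c_const (\<delta> - \<epsilon>) P (Bs 1) * ln (1 + \<delta> - \<epsilon>)))))
     \<and>
     (AE \<omega> in P.
        (\<forall>n. total_mass (\<lambda>k. Bs k \<omega>) n \<ge> 1) \<longrightarrow>
          liminf (\<lambda>n. ereal (1 / real n) * eln (total_mass (\<lambda>k. Bs k \<omega>) n))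
            \<ge> ereal (c_const \<delta> P (Bs 1) * ln (1 + \<delta>)))"
proof -
  interpret N: prob_space N by fact
  interpret copies P Bs "distr N matrix_space B"
  proof -
    have B: "B \<in> N \<rightarrow>\<^sub>M matrix_space" using assms(2) by (simp add: random_matrix_def)
    interpret prob_space P by fact
    show "copies P Bs (distr N matrix_space B)"
    proof
      show "indep_vars (\<lambda>_. matrix_space) Bs {1..}"
        "\<And>n. 1 \<le> n \<Longrightarrow> distr P matrix_space (Bs n) = distr N matrix_space B"
        using assms(5) by (auto simp: independent_copies_def)
      show "distr (distr N matrix_space B) matrix_space (translate z) = distr N matrix_space B" for z
        using assms(3) by (subst distr_distr[OF translate_measurable B])
          (simp add: comp_def translation_invariant_def translate_def)
      show "AE A in distr N matrix_space B. \<forall>x y. A (x, y) \<in> {0} \<union> {1..}"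
        using assms(2) entries_measurable
        by (subst AE_distr_iff[OF B]) (auto simp: random_matrix_def pred_def)
    qed
  qed
  have "survival_prob * leap_prob (1 + \<delta>) > 0" using assms(7) c_const_le[of \<delta>] by linarith
  moreover have "survival_prob \<ge> 0" "leap_prob a \<ge> 0" for a
    by (auto simp: survival_prob_def leap_prob_def)
  \<comment> \<open>Lowering the threshold makes leaps more likely, so positivity at \<delta>
    persists below it.\<close>
  ultimately have pos: "survival_prob * leap_prob (1 + \<delta>') > 0" if "\<delta>' \<le> \<delta>" for \<delta>'
    using leap_prob_mono[of "1 + \<delta>'" "1 + \<delta>"] that
    by (auto simp: zero_less_mult_iff intro: less_le_trans)
  \<comment> \<open>The level \<delta> itself is included: \<open>\<delta> - \<epsilon>\<close>
    gives the first claim, and \<delta> the second, since the total mass dominates the mass on the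
    path.\<close>
  have main: "\<exists>\<Gamma> :: nat \<Rightarrow> 'a \<Rightarrow> 'd site.
      (\<forall>n. \<Gamma> n \<in> P \<rightarrow>\<^sub>M count_space UNIV) \<and>
      (AE \<omega> in P. (\<forall>n. total_mass (\<lambda>k. Bs k \<omega>) n \<ge> 1) \<longrightarrow>
         open_path (\<lambda>k. Bs k \<omega>) (\<lambda>n. \<Gamma> n \<omega>) \<and>
         liminf (\<lambda>n. ereal (1 / real n) * eln (mass (\<lambda>k. Bs k \<omega>) n (\<Gamma> n \<omega>)))
           \<ge> ereal (c_const \<delta>' P (Bs 1) * ln (1 + \<delta>')))" if \<delta>': "0 \<le> \<delta>'" "\<delta>' \<le> \<delta>" for \<delta>'
  proof -
    have "ereal (c_const \<delta>' P (Bs 1) * ln (1 + \<delta>')) \<le> ereal (survival_prob * leap_prob (1 + \<delta>') * ln (1 + \<delta>'))"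
      using c_const_le[of \<delta>'] \<delta>'(1) by (auto intro!: mult_right_mono)
    note le = order_trans[OF this]
    have "1 + \<delta>' \<ge> 1" using \<delta>' by simp
    from growth_along_path[OF this pos[OF \<delta>'(2)]] obtain \<Gamma> :: "nat \<Rightarrow> 'a \<Rightarrow> 'd site" where \<Gamma>:
      "\<forall>n. \<Gamma> n \<in> P \<rightarrow>\<^sub>M count_space UNIV"
      "AE \<omega> in P. (\<forall>n. total_mass (\<lambda>k. Bs k \<omega>) n \<ge> 1) \<longrightarrow>
         open_path (\<lambda>k. Bs k \<omega>) (\<lambda>n. \<Gamma> n \<omega>) \<and>
         ereal (survival_prob * leap_prob (1 + \<delta>') * ln (1 + \<delta>'))
           \<le> liminf (\<lambda>n. ereal (1 / real n) * eln (mass (\<lambda>k. Bs k \<omega>) n (\<Gamma> n \<omega>)))" by blast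
    show ?thesis
    proof (intro exI conjI)
      show "\<forall>n. \<Gamma> n \<in> P \<rightarrow>\<^sub>M count_space UNIV" by (rule \<Gamma>(1))
      from \<Gamma>(2) show "AE \<omega> in P. (\<forall>n. total_mass (\<lambda>k. Bs k \<omega>) n \<ge> 1) \<longrightarrow>
         open_path (\<lambda>k. Bs k \<omega>) (\<lambda>n. \<Gamma> n \<omega>) \<and>
         liminf (\<lambda>n. ereal (1 / real n) * eln (mass (\<lambda>k. Bs k \<omega>) n (\<Gamma> n \<omega>)))
           \<ge> ereal (c_const \<delta>' P (Bs 1) * ln (1 + \<delta>'))"
        by eventually_elim (use le in blast)
    qed
  qed
  show ?thesis
  proof (intro conjI allI impI)
    fix \<epsilon> assume "0 < \<epsilon> \<and> \<epsilon> < \<delta>"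
    then show "\<exists>\<Gamma> :: nat \<Rightarrow> 'a \<Rightarrow> 'd site.
      (\<forall>n. \<Gamma> n \<in> P \<rightarrow>\<^sub>M count_space UNIV) \<and>
      (AE \<omega> in P. (\<forall>n. total_mass (\<lambda>k. Bs k \<omega>) n \<ge> 1) \<longrightarrow>
         open_path (\<lambda>k. Bs k \<omega>) (\<lambda>n. \<Gamma> n \<omega>) \<and>
         liminf (\<lambda>n. ereal (1 / real n) * eln (mass (\<lambda>k. Bs k \<omega>) n (\<Gamma> n \<omega>)))
           \<ge> ereal (c_const (\<delta> - \<epsilon>) P (Bs 1) * ln (1 + \<delta> - \<epsilon>)))"
      using main[of "\<delta> - \<epsilon>"] by (simp add: add_diff_eq)
  next
    obtain \<Gamma> :: "nat \<Rightarrow> 'a \<Rightarrow> 'd site" where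
      \<Gamma>: "AE \<omega> in P. (\<forall>n. total_mass (\<lambda>k. Bs k \<omega>) n \<ge> 1) \<longrightarrow>
         open_path (\<lambda>k. Bs k \<omega>) (\<lambda>n. \<Gamma> n \<omega>) \<and>
         liminf (\<lambda>n. ereal (1 / real n) * eln (mass (\<lambda>k. Bs k \<omega>) n (\<Gamma> n \<omega>)))
           \<ge> ereal (c_const \<delta> P (Bs 1) * ln (1 + \<delta>))"
      using main[of \<delta>] assms(6) by auto
    from \<Gamma> show "AE \<omega> in P. (\<forall>n. total_mass (\<lambda>k. Bs k \<omega>) n \<ge> 1) \<longrightarrow>
          liminf (\<lambda>n. ereal (1 / real n) * eln (total_mass (\<lambda>k. Bs k \<omega>) n))
            \<ge> ereal (c_const \<delta> P (Bs 1) * ln (1 + \<delta>))"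
    proof eventually_elim
      case (elim \<omega>)
      have "liminf (\<lambda>n. ereal (1 / real n) * eln (mass (\<lambda>k. Bs k \<omega>) n (\<Gamma> n \<omega>)))
          \<le> liminf (\<lambda>n. ereal (1 / real n) * eln (total_mass (\<lambda>k. Bs k \<omega>) n))"
        by (intro Liminf_mono always_eventually allI ereal_mult_left_mono eln_mono mass_le_total_mass) simp
      with elim show ?case using order_trans by blast
    qed
  qed
qed

end
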